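(* Let $n\ge 1$. Let $\operatorname{LK}_n$ be the map sending a virtual string link diagram $L$ on $n$ strands to the list of its $n(n-1)$ ordered pairwise linking numbers $\bigl(\operatorname{lk}(L_{(i)},L_{(j)})\bigr)_{1\le i\neq j\le n}\in\mathbb{Z}^{n(n-1)}$ (in lexicographic order on $(i,j)$). Then $\operatorname{LK}_n$ induces a bijection from the set $vSL_n\mathcal{B}$ of virtual string links on $n$ strands up to cobordism to $\mathbb{Z}^{n(n-1)}$, and it induces a bijection from the set $uwSL_n$ of virtual string links on $n$ strands up to unwelded equivalence to $\mathbb{Z}^{n(n-1)}$.
   Context: Diagrams. A Gauss diagram consists of a skeleton (a finite disjoint union of oriented intervals and oriented circles) together with finitely many signed arrows (signs $\pm1$) whose endpoints (tail and head) are distinct points in the interior of the skeleton, considered up to orientation-preserving homeomorphism of the skeleton fixing the labels of the intervals. A virtual string link diagram on $n$ strands is (equivalently to a planar diagram with classical and virtual crossings) a Gauss diagram whose skeleton is $n$ oriented intervals labelled $1,\dots,n$ and no circles; $L_{(i)}$ is the $i$-th strand. An arrow represents a classical crossing, pointing from the overcrossing strand to the undercrossing strand; its sign is the writhe $\operatorname{w}(c)$. Virtual crossings are not recorded. Two arrow endpoints are adjacent if they bound an arc of the skeleton with no other arrow endpoint in its interior. Reidemeister moves on Gauss diagrams. RM1: add or delete an arrow (any sign and direction) whose two endpoints are adjacent. RM2: add or delete two arrows of opposite signs whose tails are adjacent and whose heads are adjacent (in either relative order), the arcs between the tails and between the heads being disjoint. RM3: suppose there are three disjoint arcs $t,m,b$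 of the skeleton and arrows $x:t\to m$, $y:t\to b$, $z:m\to b$, with no other endpoints on these arcs, and suppose there are $\delta,\varepsilon_t,\varepsilon_m,\varepsilon_b\in\{\pm1\}$ such that the signs of $x,y,z$ are $\delta\varepsilon_t\varepsilon_m$, $\delta\varepsilon_t\varepsilon_b$, $\delta\varepsilon_m\varepsilon_b$, and such that $x$ precedes $y$ on $t$ iff $\varepsilon_t=1$, $x$ precedes $z$ on $m$ iff $\varepsilon_m=1$, $y$ precedes $z$ on $b$ iff $\varepsilon_b=1$; then the order of the two endpoints is exchanged simultaneously on each of the three arcs. Forbidden moves. $f1$ exchanges two adjacent arrow tails; $f2$ exchanges two adjacent arrow heads (arbitrary signs). Two virtual string link diagrams are unwelded equivalent if they are related by a finite sequence of Reidemeister moves and moves $f1$, $f2$. Cobordism. A cobordism between two virtual string link diagrams on $n$ strands is a finite sequence of Reidemeister moves, births (adding a circle to the skeleton carrying no arrow endpoints), deaths (deleting a circle carrying no arrow endpoints), and oriented saddle moves (choose two points of the skeleton that are not arrow endpoints, cut there and reconnect in the other orientation-respecting way), starting at one diagram and ending at the other, such that the abstract surface described by the sequence (skeleton $\times$ interval, with disks attached for births and deaths and a band for each saddle) has precisely $n$ connected components, i.e. each connected component contains exactly one strand of each end diagram. There is no restriction on genus. Two diagrams are cobordant if there is a cobordism between them. Linking numbers. For distinct components, $\operatorname{lk}(L_{(i)},L_{(j)})=\sum_{c:L_{(i)}\to L_{(j)}}\operatorname{w}(c)$, the sum of the signs of the arrows with tail on $L_{(i)}$ and head on $L_{(j)}$.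 *)

theory Defs
  imports Main "HOL-Combinatorics.Transposition"
begin

section \<open>Gauss diagrams\<close>

text \<open>
  The components of the skeleton are labelled intervals and circles. Intervals carry the label of
  their initial point; the names of circles are immaterial (see \<open>isomorphism\<close> below).
  Arrows are named by natural numbers.
\<close>

datatype component = Strand nat | Circle nat

datatype 'a endpoint = Tail 'a | Head 'a

text \<open>
  \<open>word D c\<close> lists the arrow endpoints met along the component \<open>c\<close> in the direction of its
  orientation; for a circle the list is read from an arbitrary base point. The value of
  \<open>writhe D\<close> on names that are not arrows of \<open>D\<close> is immaterial.
\<close>

record diagram =
  word :: "component \<Rightarrow> nat endpoint list option"
  writhe :: "nat \<Rightarrow> int"

definition components :: "diagram \<Rightarrow> component set" where
  "components D = dom (word D)"

definition endpoints :: "diagram \<Rightarrow> nat endpoint set" where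
  "endpoints D = (\<Union>w \<in> ran (word D). set w)"

definition arrows :: "diagram \<Rightarrow> nat set" where
  "arrows D = {a. Tail a \<in> endpoints D}"

definition gauss_diagram :: "nat \<Rightarrow> diagram \<Rightarrow> bool" where
  "gauss_diagram n D \<longleftrightarrow>
     finite (components D) \<and>
     (\<forall>i. Strand i \<in> components D \<longleftrightarrow> 1 \<le> i \<and> i \<le> n) \<and>
     (\<forall>c w. word D c = Some w \<longrightarrow> distinct w) \<and>
     (\<forall>c c' w w'. c \<noteq> c' \<and> word D c = Some w \<and> word D c' = Some w' \<longrightarrow> set w \<inter> set w' = {}) \<and>
     (\<forall>a. Tail a \<in> endpoints D \<longleftrightarrow> Head a \<in> endpoints D) \<and>
     (\<forall>a \<in> arrows D. writhe D a = 1 \<or> writhe D a = - 1)"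

definition string_link_diagrams :: "nat \<Rightarrow> diagram set" where
  "string_link_diagrams n = {D. gauss_diagram n D \<and> (\<forall>k. Circle k \<notin> components D)}"

text \<open>
  Orientation-preserving homeomorphisms of the skeleton fixing the labels of the intervals; \<open>g\<close> is
  the induced map on components. Gauss diagrams are considered up to these, so they occur as
  additional steps in all equivalence relations below.
\<close>

definition isomorphism :: "(component \<Rightarrow> component) \<Rightarrow> diagram \<Rightarrow> diagram \<Rightarrow> bool" where
  "isomorphism g D D' \<longleftrightarrow>
     bij_betw g (components D) (components D') \<and>
     (\<exists>f. inj_on f (arrows D) \<and>
          (\<forall>a \<in> arrows D. writhe D' (f a) = writhe D a) \<and>
          (\<forall>i w. word D (Strand i) = Some w \<longrightarrow>
             g (Strand i) = Strand i \<and>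
             word D' (Strand i) = Some (map (map_endpoint f) w)) \<and>
          (\<forall>k w. word D (Circle k) = Some w \<longrightarrow>
             (\<exists>k' m. g (Circle k) = Circle k' \<and>
                     word D' (Circle k') = Some (map (map_endpoint f) (rotate m w)))))"


section \<open>Local moves\<close>

text \<open>
  \<open>follows D p q\<close>: there is an arc of the skeleton running from \<open>p\<close> to \<open>q\<close> with no other
  endpoint on it. Two such arcs with disjoint sets of end points are automatically disjoint.
\<close>

definition follows :: "diagram \<Rightarrow> nat endpoint \<Rightarrow> nat endpoint \<Rightarrow> bool" where
  "follows D p q \<longleftrightarrow>
     (\<exists>c u v. word D c = Some (u @ [p, q] @ v)) \<or>
     (\<exists>k u. word D (Circle k) = Some ([q] @ u @ [p]))"

definition adjacent :: "diagram \<Rightarrow> nat endpoint \<Rightarrow> nat endpoint \<Rightarrow> bool" where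
  "adjacent D p q \<longleftrightarrow> follows D p q \<or> follows D q p"

definition delete_arrows :: "nat set \<Rightarrow> diagram \<Rightarrow> diagram" where
  "delete_arrows A D =
     D\<lparr>word := \<lambda>c. map_option (filter (\<lambda>p. p \<notin> Tail ` A \<union> Head ` A)) (word D c)\<rparr>"

definition exchange :: "nat endpoint \<Rightarrow> nat endpoint \<Rightarrow> diagram \<Rightarrow> diagram" where
  "exchange p q D =
     D\<lparr>word := \<lambda>c. map_option (map (Transposition.transpose p q)) (word D c)\<rparr>"

definition RM1 :: "diagram \<Rightarrow> diagram \<Rightarrow> bool" where
  "RM1 D D' \<longleftrightarrow> (\<exists>a. adjacent D (Tail a) (Head a) \<and> D' = delete_arrows {a} D)"

definition RM2 :: "diagram \<Rightarrow> diagram \<Rightarrow> bool" where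
  "RM2 D D' \<longleftrightarrow>
     (\<exists>a b. a \<noteq> b \<and> writhe D a = - writhe D b \<and>
            adjacent D (Tail a) (Tail b) \<and> adjacent D (Head a) (Head b) \<and>
            D' = delete_arrows {a, b} D)"

definition in_order :: "diagram \<Rightarrow> int \<Rightarrow> nat endpoint \<Rightarrow> nat endpoint \<Rightarrow> bool" where
  "in_order D e p q \<longleftrightarrow> (if e = 1 then follows D p q else follows D q p)"

definition RM3 :: "diagram \<Rightarrow> diagram \<Rightarrow> bool" where
  "RM3 D D' \<longleftrightarrow>
     (\<exists>x y z d et em eb.
        x \<noteq> y \<and> x \<noteq> z \<and> y \<noteq> z \<and>
        d \<in> {1, - 1} \<and> et \<in> {1, - 1} \<and> em \<in> {1, - 1} \<and> eb \<in> {1, - 1} \<and>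
        writhe D x = d * et * em \<and> writhe D y = d * et * eb \<and> writhe D z = d * em * eb \<and>
        in_order D et (Tail x) (Tail y) \<and>
        in_order D em (Head x) (Tail z) \<and>
        in_order D eb (Head y) (Head z) \<and>
        D' = exchange (Tail x) (Tail y) (exchange (Head x) (Tail z) (exchange (Head y) (Head z) D)))"

definition reidemeister :: "diagram \<Rightarrow> diagram \<Rightarrow> bool" where
  "reidemeister D D' \<longleftrightarrow>
     RM1 D D' \<or> RM1 D' D \<or> RM2 D D' \<or> RM2 D' D \<or> RM3 D D' \<or> RM3 D' D"

definition forbidden1 :: "diagram \<Rightarrow> diagram \<Rightarrow> bool" where
  "forbidden1 D D' \<longleftrightarrow>
     (\<exists>a b. adjacent D (Tail a) (Tail b) \<and> D' = exchange (Tail a) (Tail b) D)"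

definition forbidden2 :: "diagram \<Rightarrow> diagram \<Rightarrow> bool" where
  "forbidden2 D D' \<longleftrightarrow>
     (\<exists>a b. adjacent D (Head a) (Head b) \<and> D' = exchange (Head a) (Head b) D)"


section \<open>Unwelded equivalence\<close>

definition unwelded_moves :: "nat \<Rightarrow> (diagram \<times> diagram) set" where
  "unwelded_moves n =
     {(D, D'). D \<in> string_link_diagrams n \<and> D' \<in> string_link_diagrams n \<and>
        ((\<exists>g. isomorphism g D D') \<or> reidemeister D D' \<or> forbidden1 D D' \<or> forbidden2 D D')}"

definition unwelded_equivalent :: "nat \<Rightarrow> (diagram \<times> diagram) set" where
  "unwelded_equivalent n =
     Restr ((unwelded_moves n \<union> (unwelded_moves n)\<inverse>)\<^sup>*) (string_link_diagrams n)"


section \<open>Cobordism\<close>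

text \<open>
  In \<open>saddle K K' D D'\<close>, the set \<open>K\<close> consists of the components of \<open>D\<close> that are cut and \<open>K'\<close> of the
  components of \<open>D'\<close> that result. \<open>saddle_split\<close> covers two points on the same component (interval
  or circle). Its converse joins a circle to another component; the points of the circles at which
  this happens are arbitrary because base points can be changed by an isomorphism.
  \<open>saddle_strands\<close> covers points on two different intervals, which exchange their terminal parts.
\<close>

definition saddle_split ::
  "component set \<Rightarrow> component set \<Rightarrow> diagram \<Rightarrow> diagram \<Rightarrow> bool" where
  "saddle_split K K' D D' \<longleftrightarrow>
     (\<exists>c k u v w. word D c = Some (u @ v @ w) \<and> Circle k \<notin> components D \<and>
        K = {c} \<and> K' = {c, Circle k} \<and>
        D' = D\<lparr>word := (word D)(c \<mapsto> u @ w, Circle k \<mapsto> v)\<rparr>)"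

definition saddle_strands ::
  "component set \<Rightarrow> component set \<Rightarrow> diagram \<Rightarrow> diagram \<Rightarrow> bool" where
  "saddle_strands K K' D D' \<longleftrightarrow>
     (\<exists>i j u v u' v'. i \<noteq> j \<and>
        word D (Strand i) = Some (u @ v) \<and> word D (Strand j) = Some (u' @ v') \<and>
        K = {Strand i, Strand j} \<and> K' = {Strand i, Strand j} \<and>
        D' = D\<lparr>word := (word D)(Strand i \<mapsto> u @ v', Strand j \<mapsto> u' @ v)\<rparr>)"

definition saddle ::
  "component set \<Rightarrow> component set \<Rightarrow> diagram \<Rightarrow> diagram \<Rightarrow> bool" where
  "saddle K K' D D' \<longleftrightarrow>
     saddle_split K K' D D' \<or> saddle_split K' K D' D \<or> saddle_strands K K' D D'"

definition birth :: "diagram \<Rightarrow> diagram \<Rightarrow> bool" where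
  "birth D D' \<longleftrightarrow>
     (\<exists>k. Circle k \<notin> components D \<and> D' = D\<lparr>word := (word D)(Circle k \<mapsto> [])\<rparr>)"

text \<open>
  \<open>cobordism_step D R D'\<close>: one step from \<open>D\<close> to \<open>D'\<close>, where \<open>R\<close> relates a component of \<open>D\<close> to a
  component of \<open>D'\<close> iff they bound the same connected piece of the surface traced out by the step
  (annuli and strips, and the piece containing the band of a saddle). The disk of a birth
  (death) meets only \<open>D'\<close> (only \<open>D\<close>) and contributes nothing to \<open>R\<close>.
\<close>

inductive cobordism_step :: "diagram \<Rightarrow> component rel \<Rightarrow> diagram \<Rightarrow> bool" where
  isomorphism:
    "isomorphism g D D' \<Longrightarrow> cobordism_step D {(c, g c) |c. c \<in> components D} D'"
| reidemeister:
    "reidemeister D D' \<Longrightarrow> cobordism_step D (Id_on (components D)) D'"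
| birth:
    "birth D D' \<Longrightarrow> cobordism_step D (Id_on (components D)) D'"
| death:
    "birth D' D \<Longrightarrow> cobordism_step D (Id_on (components D')) D'"
| saddle:
    "saddle K K' D D' \<Longrightarrow> cobordism_step D (Id_on (components D - K) \<union> K \<times> K') D'"

text \<open>
  A movie is a sequence of diagrams \<open>Ds\<close>; \<open>Rs ! t\<close> is the trace of the step from \<open>Ds ! t\<close> to
  \<open>Ds ! Suc t\<close>.
\<close>

definition movie :: "nat \<Rightarrow> diagram list \<Rightarrow> component rel list \<Rightarrow> bool" where
  "movie n Ds Rs \<longleftrightarrow>
     length Ds = Suc (length Rs) \<and>
     (\<forall>D \<in> set Ds. gauss_diagram n D) \<and>
     (\<forall>t < length Rs. cobordism_step (Ds ! t) (Rs ! t) (Ds ! Suc t))"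

definition slices :: "diagram list \<Rightarrow> (nat \<times> component) set" where
  "slices Ds = {(t, c). t < length Ds \<and> c \<in> components (Ds ! t)}"

definition joined :: "component rel list \<Rightarrow> (nat \<times> component) rel" where
  "joined Rs = {((t, c), (Suc t, c')) |t c c'. t < length Rs \<and> (c, c') \<in> Rs ! t}"

text \<open>
  The connected components of the surface, each given by the set of slices (components of the
  diagrams at the various times) contained in it.
\<close>

definition surface_components ::
  "diagram list \<Rightarrow> component rel list \<Rightarrow> (nat \<times> component) set set" where
  "surface_components Ds Rs =
     slices Ds // Restr ((joined Rs \<union> (joined Rs)\<inverse>)\<^sup>*) (slices Ds)"

definition cobordism :: "nat \<Rightarrow> diagram list \<Rightarrow> component rel list \<Rightarrow> bool" where
  "cobordism n Ds Rs \<longleftrightarrow>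
     movie n Ds Rs \<and>
     hd Ds \<in> string_link_diagrams n \<and> last Ds \<in> string_link_diagrams n \<and>
     card (surface_components Ds Rs) = n \<and>
     (\<forall>X \<in> surface_components Ds Rs.
        (\<exists>!i. (0, Strand i) \<in> X) \<and> (\<exists>!i. (length Rs, Strand i) \<in> X))"

definition cobordant :: "nat \<Rightarrow> (diagram \<times> diagram) set" where
  "cobordant n = {(D, D'). \<exists>Ds Rs. cobordism n Ds Rs \<and> hd Ds = D \<and> last Ds = D'}"


section \<open>Linking numbers\<close>

definition on_strand :: "diagram \<Rightarrow> nat \<Rightarrow> nat endpoint set" where
  "on_strand D i = {p. \<exists>w. word D (Strand i) = Some w \<and> p \<in> set w}"

definition lk :: "diagram \<Rightarrow> nat \<Rightarrow> nat \<Rightarrow> int" where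
  "lk D i j = (\<Sum>a | Tail a \<in> on_strand D i \<and> Head a \<in> on_strand D j. writhe D a)"

definition LK :: "nat \<Rightarrow> diagram \<Rightarrow> int list" where
  "LK n D = [lk D i j. i \<leftarrow> [1..<Suc n], j \<leftarrow> [1..<Suc n], i \<noteq> j]"

text \<open>\<open>f\<close> is constant on the classes of \<open>r\<close> and descends to a bijection from \<open>A // r\<close> to \<open>B\<close>.\<close>

definition induces_bijection :: "('a \<Rightarrow> 'b) \<Rightarrow> 'a set \<Rightarrow> 'a rel \<Rightarrow> 'b set \<Rightarrow> bool" where
  "induces_bijection f A r B \<longleftrightarrow>
     equiv A r \<and> f respects r \<and> bij_betw (\<lambda>X. the_elem (f ` X)) (A // r) B"

end

(*
  Both equivalence relations turn out to be the kernel of LK.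

  Invariance under cobordism: label each slice of the surface by the strand whose component it
  belongs to, and count arrows from label i to label j. A strand never leaves its component, so at
  both ends this is the linking number, and no step of the movie changes the count.

  Conversely, adjacent endpoints can always be exchanged by unwelded moves (a head and a tail of
  different arrows by means of RM2, RM3 and the forbidden moves), so only the strands on which the
  arrows start and end matter. RM1 and RM2 then remove arrows from a strand to itself and pairs of
  opposite arrows, and what remains is determined by the linking numbers. Finally, unwelded moves
  are realised by cobordisms: a forbidden move is a saddle followed by its inverse.
*)

theory Submission
  imports Defs "HOL-Library.Multiset" "HOL-Library.Nat_Bijection"
begin

section \<open>Gauss diagrams and local moves\<close>

text \<open>Neither invariance under unwelded moves nor completeness for cobordism is proved on its
  own. Unwelded equivalence implies cobordism, cobordism implies equal linking numbers, and equal
  linking numbers imply unwelded equivalence, so one circle of implications settles both relations.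

  The obstacle to invariance is that saddles carry endpoints between strands and circles, so that
  counting arrows between the strands of an intermediate diagram gives no invariant. The labels
  therefore have to come from the surface. Its genus is harmless because only connectedness enters,
  and counting arrows between distinct labels only is what absorbs RM1.

  The obstacle to sorting endpoints is a head next to the tail of another arrow, a pair to which no
  move applies directly. RM3 exchanges it in the presence of a third arrow; whatever the signs and
  the order of the given pair, the third arrow can be placed and signed to fit.\<close>

definition points :: "diagram \<Rightarrow> component \<Rightarrow> nat endpoint set" where
  "points D c = (case word D c of None \<Rightarrow> {} | Some w \<Rightarrow> set w)"

lemma points_Some [simp]: "word D c = Some w \<Longrightarrow> points D c = set w"
  by (simp add: points_def)

lemma in_points_iff: "p \<in> points D c \<longleftrightarrow> (\<exists>w. word D c = Some w \<and> p \<in> set w)"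
  by (auto simp: points_def split: option.splits)

lemma points_component: "p \<in> points D c \<Longrightarrow> c \<in> components D"
  by (auto simp: in_points_iff components_def)

lemma endpoints_eq: "endpoints D = (\<Union>c. points D c)"
proof -
  have "(\<exists>w \<in> ran (word D). p \<in> set w) \<longleftrightarrow> (\<exists>c. p \<in> points D c)" for p
    unfolding in_points_iff ran_def by blast
  then show ?thesis
    by (auto simp: endpoints_def)
qed

lemma gauss_diagram_word_eq:
  assumes "gauss_diagram n D" "word D c = Some w" "word D c' = Some w'" "p \<in> set w" "p \<in> set w'"
  shows "c = c'" "w = w'"
proof -
  show "c = c'"
    using assms unfolding gauss_diagram_def by (metis disjoint_iff)
  then show "w = w'"
    using assms by simp
qed

lemma in_endpoints_iff: "p \<in> endpoints D \<longleftrightarrow> (\<exists>c w. word D c = Some w \<and> p \<in> set w)"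
  by (auto simp: endpoints_eq in_points_iff)

lemma gauss_diagramI:
  assumes "finite (components D)" "\<And>i. Strand i \<in> components D \<longleftrightarrow> 1 \<le> i \<and> i \<le> n"
    and "\<And>c w. word D c = Some w \<Longrightarrow> distinct w"
    and "\<And>c c' p. p \<in> points D c \<Longrightarrow> p \<in> points D c' \<Longrightarrow> c = c'"
    and "\<And>a. Tail a \<in> endpoints D \<longleftrightarrow> Head a \<in> endpoints D"
    and "\<And>a. a \<in> arrows D \<Longrightarrow> writhe D a = 1 \<or> writhe D a = - 1"
  shows "gauss_diagram n D"
proof -
  have "set w \<inter> set w' = {}" if "c \<noteq> c'" "word D c = Some w" "word D c' = Some w'" for c c' w w'
    using that assms(4)[of _ c c'] by auto
  then show ?thesis
    unfolding gauss_diagram_def using assms by blast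
qed

lemma gauss_diagramD:
  assumes "gauss_diagram n D"
  shows "finite (components D)" "Strand i \<in> components D \<longleftrightarrow> 1 \<le> i \<and> i \<le> n"
    and "word D c = Some w \<Longrightarrow> distinct w"
    and "p \<in> points D c \<Longrightarrow> p \<in> points D c' \<Longrightarrow> c = c'"
    and "Tail a \<in> endpoints D \<longleftrightarrow> Head a \<in> endpoints D"
    and "a \<in> arrows D \<Longrightarrow> writhe D a = 1 \<or> writhe D a = - 1"
  using assms gauss_diagram_word_eq(1)[OF assms] unfolding gauss_diagram_def in_points_iff by blast+

lemma finite_endpoints:
  assumes "gauss_diagram n D"
  shows "finite (endpoints D)"
proof -
  have "finite (dom (word D))"
    using assms unfolding gauss_diagram_def components_def by blast
  then show ?thesis
    unfolding endpoints_def by (intro finite_UN_I finite_ran) auto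
qed

lemma arrows_iff_Head: "gauss_diagram n D \<Longrightarrow> a \<in> arrows D \<longleftrightarrow> Head a \<in> endpoints D"
  unfolding gauss_diagram_def arrows_def by blast

lemma finite_arrows: "gauss_diagram n D \<Longrightarrow> finite (arrows D)"
  using finite_vimageI[OF finite_endpoints, of n D Tail]
  by (simp add: arrows_def vimage_def inj_def)

section \<open>Adjacency, exchanges and deletions of endpoints\<close>

lemma follows_same_component:
  assumes "follows D p q"
  obtains c where "p \<in> points D c" "q \<in> points D c"
  using assms unfolding follows_def
proof (elim disjE exE)
  fix c u v assume "word D c = Some (u @ [p, q] @ v)"
  then show thesis
    by (intro that[of c]) simp_all
next
  fix k u assume "word D (Circle k) = Some ([q] @ u @ [p])"
  then show thesis
    by (intro that[of "Circle k"]) simp_all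
qed

lemma adjacent_same_component:
  assumes "adjacent D p q"
  obtains c where "p \<in> points D c" "q \<in> points D c"
  using assms unfolding adjacent_def by (meson follows_same_component)

lemma in_order_same_component:
  assumes "in_order D e p q"
  obtains c where "p \<in> points D c" "q \<in> points D c"
  using assms unfolding in_order_def by (metis follows_same_component)

lemma word_exchange [simp]:
  "word (exchange p q D) c = map_option (map (Transposition.transpose p q)) (word D c)"
  by (simp add: exchange_def)

lemma writhe_exchange [simp]: "writhe (exchange p q D) = writhe D"
  by (simp add: exchange_def)

lemma components_exchange [simp]: "components (exchange p q D) = components D"
  by (auto simp: components_def dom_def)

lemma word_delete_arrows [simp]:
  "word (delete_arrows A D) c = map_option (filter (\<lambda>p. p \<notin> Tail ` A \<union> Head ` A)) (word D c)"
  by (simp add: delete_arrows_def)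

lemma writhe_delete_arrows [simp]: "writhe (delete_arrows A D) = writhe D"
  by (simp add: delete_arrows_def)

lemma components_delete_arrows [simp]: "components (delete_arrows A D) = components D"
  by (auto simp: components_def dom_def)

lemma points_exchange: "points (exchange p q D) c = Transposition.transpose p q ` points D c"
  by (simp add: points_def split: option.splits)

lemma points_delete_arrows: "points (delete_arrows A D) c = points D c - (Tail ` A \<union> Head ` A)"
  by (auto simp: points_def split: option.splits)

lemma components_reidemeister: "reidemeister D D' \<Longrightarrow> components D' = components D"
  unfolding reidemeister_def RM1_def RM2_def RM3_def by force


section \<open>Linking numbers of labelled diagrams\<close>

text \<open>The labels will be the values, at a fixed time, of a function that is constant on each
  connected piece of a surface. A circle may share its label with a strand, so an arrow that ends on
  a circle is still counted for that strand.\<close>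

definition region :: "(component \<Rightarrow> 'l) \<Rightarrow> diagram \<Rightarrow> 'l \<Rightarrow> nat endpoint set" where
  "region l D i = {p. \<exists>c. p \<in> points D c \<and> l c = i}"

definition region_lk :: "(component \<Rightarrow> 'l) \<Rightarrow> diagram \<Rightarrow> 'l \<Rightarrow> 'l \<Rightarrow> int" where
  "region_lk l D i j = (\<Sum>a | Tail a \<in> region l D i \<and> Head a \<in> region l D j. writhe D a)"

lemma region_cong:
  "(\<And>c. c \<in> components D \<Longrightarrow> l c = l' c) \<Longrightarrow> region l D i = region l' D i"
  unfolding region_def using points_component by (metis (no_types, lifting))

lemma region_lk_cong_region:
  "region l D = region l' D' \<Longrightarrow> writhe D = writhe D' \<Longrightarrow> region_lk l D = region_lk l' D'"
  by (simp add: fun_eq_iff region_lk_def)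

lemma region_disjoint:
  assumes "gauss_diagram n D" "p \<in> region l D i" "p \<in> region l D j"
  shows "i = j"
  using assms gauss_diagram_word_eq(1)[OF assms(1)] unfolding region_def in_points_iff by blast

lemma finite_region_arrows:
  assumes "gauss_diagram n D"
  shows "finite {a. Tail a \<in> region l D i \<and> Head a \<in> region l D j}"
proof (rule finite_subset[OF _ finite_arrows[OF assms]])
  show "{a. Tail a \<in> region l D i \<and> Head a \<in> region l D j} \<subseteq> arrows D"
    unfolding region_def arrows_def endpoints_eq by blast
qed

lemma same_region:
  assumes "gauss_diagram n D" "p \<in> points D c" "q \<in> points D c"
  shows "p \<in> region l D i \<longleftrightarrow> q \<in> region l D i"
  using assms(2,3) gauss_diagramD(4)[OF assms(1)] unfolding region_def by blast

lemma adjacent_same_region: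
  assumes "gauss_diagram n D" "adjacent D p q"
  shows "p \<in> region l D i \<longleftrightarrow> q \<in> region l D i"
  using assms(2) by (rule adjacent_same_component) (rule same_region[OF assms(1)])

section \<open>Invariance of labelled counts under Reidemeister moves\<close>

lemma region_delete_arrows:
  "region l (delete_arrows A D) i = region l D i - (Tail ` A \<union> Head ` A)"
  by (auto simp: region_def points_delete_arrows)

text \<open>A transposition maps every set containing both or neither of its two points onto itself,
  and the endpoint set of each component is of this kind.\<close>

lemma region_exchange:
  assumes "gauss_diagram n D" "p \<in> points D c" "q \<in> points D c"
  shows "region l (exchange p q D) = region l D"
proof -
  have "points (exchange p q D) c' = points D c'" for c'
    unfolding points_exchange using assms(2,3) gauss_diagramD(4)[OF assms(1)]
    by (intro transpose_image_eq) metis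
  then show ?thesis
    by (simp add: region_def fun_eq_iff)
qed

text \<open>Any permutation of the endpoints present preserves the axioms, whether or not the two
  are adjacent. This covers the intermediate stages of RM3, which need not be reachable by a legal
  move.\<close>

lemma gauss_diagram_exchange:
  assumes D: "gauss_diagram n D" and "p \<in> endpoints D" "q \<in> endpoints D"
  shows "gauss_diagram n (exchange p q D)"
proof -
  have "endpoints (exchange p q D) = Transposition.transpose p q ` endpoints D"
    by (auto simp: endpoints_eq points_exchange)
  also have "\<dots> = endpoints D"
    using assms by (intro transpose_image_eq) simp
  finally have E: "endpoints (exchange p q D) = endpoints D" .
  then have A: "arrows (exchange p q D) = arrows D"
    by (simp add: arrows_def)
  have inj: "inj_on (Transposition.transpose p q) S" for S
    by (metis inj_on_inverseI transpose_involutory)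
  show ?thesis
  proof (rule gauss_diagramI)
    show "distinct w" if "word (exchange p q D) c = Some w" for c w
      using that gauss_diagramD(3)[OF D] inj by (auto simp: distinct_map)
    show "c = c'" if "r \<in> points (exchange p q D) c" "r \<in> points (exchange p q D) c'" for r c c'
      using that gauss_diagramD(4)[OF D] unfolding points_exchange
      by (metis imageE transpose_involutory)
  qed (simp_all add: E A gauss_diagramD[OF D])
qed

lemma region_lk_exchange:
  assumes "gauss_diagram n D" "p \<in> points D c" "q \<in> points D c"
  shows "region_lk l (exchange p q D) = region_lk l D"
  by (rule region_lk_cong_region) (simp_all add: region_exchange[OF assms])

text \<open>The deleted arrow has both ends on one component, so it contributes only to pairs of
  equal labels. This is where \<open>i \<noteq> j\<close> enters the invariance.\<close>

lemma region_lk_RM1: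
  assumes D: "gauss_diagram n D" and "RM1 D D'" and "i \<noteq> j"
  shows "region_lk l D' i j = region_lk l D i j"
proof -
  obtain a where a: "adjacent D (Tail a) (Head a)" and D': "D' = delete_arrows {a} D"
    using assms(2) unfolding RM1_def by blast
  have "\<not> (Tail a \<in> region l D i \<and> Head a \<in> region l D j)"
    using adjacent_same_region[OF D a, of l i] region_disjoint[OF D, of "Head a" l i j] \<open>i \<noteq> j\<close> by metis
  then have "{b. Tail b \<in> region l D' i \<and> Head b \<in> region l D' j} =
      {b. Tail b \<in> region l D i \<and> Head b \<in> region l D j}"
    unfolding D' region_delete_arrows by (intro set_eqI) (simp; blast)
  then show ?thesis
    by (simp add: region_lk_def D')
qed

text \<open>Adjacency puts the two tails into one region and the two heads into one region, so the
  sum contains both arrows or neither, and opposite signs cancel.\<close>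

lemma region_lk_RM2:
  assumes D: "gauss_diagram n D" and "RM2 D D'"
  shows "region_lk l D' i j = region_lk l D i j"
proof -
  obtain a b where ab: "a \<noteq> b" "writhe D a = - writhe D b"
      "adjacent D (Tail a) (Tail b)" "adjacent D (Head a) (Head b)"
    and D': "D' = delete_arrows {a, b} D"
    using assms(2) unfolding RM2_def by blast
  let ?S = "{c. Tail c \<in> region l D i \<and> Head c \<in> region l D j}"
  have S': "{c. Tail c \<in> region l D' i \<and> Head c \<in> region l D' j} = ?S - {a, b}"
    unfolding D' region_delete_arrows by (intro set_eqI) (simp; blast)
  have iff: "a \<in> ?S \<longleftrightarrow> b \<in> ?S"
    using adjacent_same_region[OF D ab(3), of l i] adjacent_same_region[OF D ab(4), of l j] by simp
  have "sum (writhe D) (?S - {a, b}) = sum (writhe D) ?S"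
  proof (cases "a \<in> ?S")
    case True
    then have "{a, b} \<subseteq> ?S"
      using iff by blast
    then have "sum (writhe D) ?S = sum (writhe D) (?S - {a, b}) + sum (writhe D) {a, b}"
      by (rule sum.subset_diff) (rule finite_region_arrows[OF D])
    then show ?thesis
      using ab(1,2) by simp
  next
    case False
    then have "?S - {a, b} = ?S"
      using iff by blast
    then show ?thesis
      by simp
  qed
  then show ?thesis
    unfolding region_lk_def S' by (simp add: D')
qed

text \<open>The move is a composition of three exchanges, each within a single component. As
  \<open>x\<close>, \<open>y\<close>, \<open>z\<close> are distinct, an earlier exchange does not
  touch the endpoints used by a later one.\<close>

lemma region_lk_RM3:
  assumes D: "gauss_diagram n D" and "RM3 D D'"
  shows "region_lk l D' = region_lk l D"
proof -
  obtain x y z et em eb where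
      o: "in_order D et (Tail x) (Tail y)" "in_order D em (Head x) (Tail z)"
        "in_order D eb (Head y) (Head z)"
    and ne: "x \<noteq> y" "x \<noteq> z" "y \<noteq> z"
    and D': "D' = exchange (Tail x) (Tail y) (exchange (Head x) (Tail z) (exchange (Head y) (Head z) D))"
    using assms(2) unfolding RM3_def by blast
  obtain c1 where c1: "Tail x \<in> points D c1" "Tail y \<in> points D c1"
    using o(1) by (rule in_order_same_component)
  obtain c2 where c2: "Head x \<in> points D c2" "Tail z \<in> points D c2"
    using o(2) by (rule in_order_same_component)
  obtain c3 where c3: "Head y \<in> points D c3" "Head z \<in> points D c3"
    using o(3) by (rule in_order_same_component)
  define D1 where "D1 = exchange (Head y) (Head z) D"
  define D2 where "D2 = exchange (Head x) (Tail z) D1"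
  have keep: "r \<in> points (exchange p q E) c" if "r \<in> points E c" "r \<noteq> p" "r \<noteq> q" for r p q c E
    unfolding points_exchange using that by (metis image_eqI transpose_apply_other)
  have D1: "gauss_diagram n D1"
    unfolding D1_def using c3 by (intro gauss_diagram_exchange[OF D]) (auto simp: endpoints_eq)
  have c2': "Head x \<in> points D1 c2" "Tail z \<in> points D1 c2"
    unfolding D1_def using c2 ne by (auto intro!: keep)
  have D2: "gauss_diagram n D2"
    unfolding D2_def using c2' by (intro gauss_diagram_exchange[OF D1]) (auto simp: endpoints_eq)
  have c1': "Tail x \<in> points D2 c1" "Tail y \<in> points D2 c1"
    unfolding D1_def D2_def using c1 ne by (auto intro!: keep)
  have "region_lk l D' = region_lk l D2"
    unfolding D' D1_def[symmetric] D2_def[symmetric] by (rule region_lk_exchange[OF D2 c1'])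
  also have "\<dots> = region_lk l D1"
    unfolding D2_def by (rule region_lk_exchange[OF D1 c2'])
  also have "\<dots> = region_lk l D"
    unfolding D1_def by (rule region_lk_exchange[OF D c3])
  finally show ?thesis .
qed

lemma region_lk_reidemeister:
  assumes "gauss_diagram n D" "gauss_diagram n D'" "reidemeister D D'" "i \<noteq> j"
  shows "region_lk l D i j = region_lk l D' i j"
  using assms region_lk_RM1 region_lk_RM2 region_lk_RM3 unfolding reidemeister_def by metis

text \<open>Passing to sets of endpoints forgets the rotation allowed on circles, so that strands
  and circles can be treated alike.\<close>

lemma isomorphism_word:
  assumes "isomorphism g D D'"
  obtains f where "inj_on f (arrows D)" "\<And>a. a \<in> arrows D \<Longrightarrow> writhe D' (f a) = writhe D a"
    "\<And>c w. word D c = Some w \<Longrightarrow>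
      \<exists>w'. word D' (g c) = Some w' \<and> set w' = map_endpoint f ` set w"
proof -
  obtain f where f: "inj_on f (arrows D)" "\<forall>a \<in> arrows D. writhe D' (f a) = writhe D a"
    "\<forall>i w. word D (Strand i) = Some w \<longrightarrow>
             g (Strand i) = Strand i \<and> word D' (Strand i) = Some (map (map_endpoint f) w)"
    "\<forall>k w. word D (Circle k) = Some w \<longrightarrow>
             (\<exists>k' m. g (Circle k) = Circle k' \<and>
                     word D' (Circle k') = Some (map (map_endpoint f) (rotate m w)))"
    using assms unfolding isomorphism_def by blast
  show ?thesis
  proof (rule that[OF f(1)])
    fix c w assume w: "word D c = Some w"
    show "\<exists>w'. word D' (g c) = Some w' \<and> set w' = map_endpoint f ` set w"
    proof (cases c)
      case (Strand i)
      then show ?thesis using w f(3) by auto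
    next
      case (Circle k)
      with w f(4) obtain k' m where "g c = Circle k'"
        "word D' (Circle k') = Some (map (map_endpoint f) (rotate m w))" by blast
      then show ?thesis by auto
    qed
  qed (use f(2) in blast)
qed

lemma region_lk_isomorphism:
  assumes D: "gauss_diagram n D" and D': "gauss_diagram n D'" and "isomorphism g D D'"
    and l: "\<And>c. c \<in> components D \<Longrightarrow> l c = l' (g c)"
  shows "region_lk l D i j = region_lk l' D' i j"
proof -
  obtain f where f: "inj_on f (arrows D)" "\<And>a. a \<in> arrows D \<Longrightarrow> writhe D' (f a) = writhe D a"
    "\<And>c w. word D c = Some w \<Longrightarrow>
      \<exists>w'. word D' (g c) = Some w' \<and> set w' = map_endpoint f ` set w"
    using isomorphism_word[OF assms(3)] by metis
  have g: "bij_betw g (components D) (components D')"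
    using assms(3) unfolding isomorphism_def by blast
  have R: "region l' D' i = map_endpoint f ` region l D i" for i
  proof (intro set_eqI iffI)
    fix p assume "p \<in> region l' D' i"
    then obtain c' w' where w': "word D' c' = Some w'" "p \<in> set w'" "l' c' = i"
      unfolding region_def in_points_iff by blast
    then have "c' \<in> g ` components D"
      using g by (auto simp: bij_betw_def components_def)
    then obtain c w where w: "c' = g c" "word D c = Some w"
      unfolding components_def by blast
    then have "c \<in> components D"
      by (auto simp: components_def)
    then show "p \<in> map_endpoint f ` region l D i"
      using f(3)[OF w(2)] w w' l by (fastforce simp: region_def in_points_iff)
  next
    fix p assume "p \<in> map_endpoint f ` region l D i"
    then obtain c w q where w: "word D c = Some w" "q \<in> set w" "l c = i" "p = map_endpoint f q"
      unfolding region_def in_points_iff by blast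
    then have "c \<in> components D"
      by (auto simp: components_def)
    then show "p \<in> region l' D' i"
      using f(3)[OF w(1)] w l by (fastforce simp: region_def in_points_iff)
  qed
  let ?S = "{a. Tail a \<in> region l D i \<and> Head a \<in> region l D j}"
  have S: "?S \<subseteq> arrows D"
    unfolding region_def arrows_def endpoints_eq by blast
  have "{a. Tail a \<in> region l' D' i \<and> Head a \<in> region l' D' j} = f ` ?S"
  proof (intro set_eqI iffI)
    fix a assume "a \<in> {a. Tail a \<in> region l' D' i \<and> Head a \<in> region l' D' j}"
    then have "Tail a \<in> map_endpoint f ` region l D i" "Head a \<in> map_endpoint f ` region l D j"
      unfolding R by auto
    then obtain p q where p: "Tail a = map_endpoint f p" "p \<in> region l D i"
      and q: "Head a = map_endpoint f q" "q \<in> region l D j" by blast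
    obtain b where b: "p = Tail b" "f b = a" using p(1) by (cases p) auto
    obtain b' where b': "q = Head b'" "f b' = a" using q(1) by (cases q) auto
    \<comment> \<open>The tail and the head were pulled back separately. They belong to the same
      arrow because \<open>f\<close> is injective, but only on \<open>arrows D\<close>, so both
      preimages must first be recognised as arrows.\<close>
    have "b \<in> arrows D"
      using p(2) b unfolding region_def arrows_def endpoints_eq by blast
    moreover have "b' \<in> arrows D"
      using q(2) b' unfolding arrows_iff_Head[OF D] region_def endpoints_eq by blast
    ultimately have "b = b'"
      using f(1) b b' unfolding inj_on_def by blast
    then show "a \<in> f ` ?S"
      using p q b b' by blast
  next
    fix a assume "a \<in> f ` ?S"
    then obtain b where b: "a = f b" "Tail b \<in> region l D i" "Head b \<in> region l D j" by blast
    have "Tail a = map_endpoint f (Tail b)" "Head a = map_endpoint f (Head b)"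
      using b by auto
    then show "a \<in> {a. Tail a \<in> region l' D' i \<and> Head a \<in> region l' D' j}"
      unfolding R using b by blast
  qed
  then have "region_lk l' D' i j = sum (writhe D') (f ` ?S)"
    by (simp add: region_lk_def)
  also have "\<dots> = (\<Sum>a\<in>?S. writhe D' (f a))"
    using inj_on_subset[OF f(1) S] by (simp add: sum.reindex)
  also have "\<dots> = sum (writhe D) ?S"
    using S f(2) by (intro sum.cong) auto
  finally show ?thesis
    by (simp add: region_lk_def)
qed

section \<open>Invariance of labelled counts under births and saddles\<close>

lemma region_birth:
  assumes "birth D D'" "\<And>c. c \<in> components D \<Longrightarrow> l c = l' c"
  shows "region l D = region l' D'"
proof -
  obtain k where k: "Circle k \<notin> components D" "D' = D\<lparr>word := (word D)(Circle k \<mapsto> [])\<rparr>"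
    using assms(1) unfolding birth_def by blast
  moreover have "region l D i = region l' D i" for i
    using assms(2) by (rule region_cong)
  moreover have "points D' c = points D c" for c
    using k by (auto simp: components_def points_def)
  ultimately show ?thesis
    by (simp add: region_def fun_eq_iff)
qed

text \<open>A saddle rewrites the words of two components only; splitting the quantifier isolates
  them from the untouched ones.\<close>

lemma ex_split_two: "(\<exists>d. P d) \<longleftrightarrow> (\<exists>d. d \<noteq> a \<and> d \<noteq> b \<and> P d) \<or> P a \<or> P b"
  by metis

text \<open>Endpoints move only from \<open>c\<close> to the new circle. The hypothesis on
  \<open>K\<close> and \<open>K'\<close> says that both sides of the band have one label, so no
  endpoint changes its region.\<close>

lemma region_saddle_split:
  assumes "saddle_split K K' D D'"
    and l: "\<And>c. c \<in> components D - K \<Longrightarrow> l c = l' c" "\<And>c c'. c \<in> K \<Longrightarrow> c' \<in> K' \<Longrightarrow> l c = l' c'"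
  shows "region l D = region l' D'"
proof -
  obtain c k u v w where h: "word D c = Some (u @ v @ w)" "Circle k \<notin> components D"
    "K = {c}" "K' = {c, Circle k}" "D' = D\<lparr>word := (word D)(c \<mapsto> u @ w, Circle k \<mapsto> v)\<rparr>"
    using assms(1) unfolding saddle_split_def by blast
  have lc: "l c = l' c" "l c = l' (Circle k)"
    using l(2) h by auto
  have "region l D i = region l' D i" for i
    using l h lc by (intro region_cong) (metis DiffI singletonD)
  moreover have ck: "c \<noteq> Circle k"
    using h unfolding components_def by auto
  have "region l' D i = region l' D' i" for i
  proof (intro set_eqI)
    fix p
    have "p \<in> region l' D i \<longleftrightarrow> (\<exists>d. d \<noteq> c \<and> d \<noteq> Circle k \<and> p \<in> points D d \<and> l' d = i) \<or>
       (p \<in> points D c \<and> l' c = i) \<or> (p \<in> points D (Circle k) \<and> l' (Circle k) = i)"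
      unfolding region_def mem_Collect_eq by (rule ex_split_two)
    also have "\<dots> \<longleftrightarrow> (\<exists>d. d \<noteq> c \<and> d \<noteq> Circle k \<and> p \<in> points D' d \<and> l' d = i) \<or>
        (p \<in> points D' c \<and> l' c = i) \<or> (p \<in> points D' (Circle k) \<and> l' (Circle k) = i)"
      using ck lc h(1,2) by (auto simp: h(5) points_def components_def)
    also have "\<dots> \<longleftrightarrow> p \<in> region l' D' i"
      unfolding region_def mem_Collect_eq by (rule ex_split_two[symmetric])
    finally show "p \<in> region l' D i \<longleftrightarrow> p \<in> region l' D' i" .
  qed
  ultimately show ?thesis
    by auto
qed

text \<open>Since every component in \<open>K\<close> agrees in label with every component in
  \<open>K'\<close>, the two strands have the same label, and exchanging their terminal parts moves
  endpoints within one region.\<close>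

lemma region_saddle_strands:
  assumes "saddle_strands K K' D D'"
    and l: "\<And>c. c \<in> components D - K \<Longrightarrow> l c = l' c" "\<And>c c'. c \<in> K \<Longrightarrow> c' \<in> K' \<Longrightarrow> l c = l' c'"
  shows "region l D = region l' D'"
proof -
  obtain i j u v u' v' where h: "i \<noteq> j"
         "word D (Strand i) = Some (u @ v)" "word D (Strand j) = Some (u' @ v')"
         "K = {Strand i, Strand j}" "K' = {Strand i, Strand j}"
         "D' = D\<lparr>word := (word D)(Strand i \<mapsto> u @ v', Strand j \<mapsto> u' @ v)\<rparr>"
    using assms(1) unfolding saddle_strands_def by blast
  have lc: "l (Strand i) = l' (Strand i)" "l (Strand j) = l' (Strand j)" "l' (Strand i) = l' (Strand j)"
    using l(2)[of "Strand i" "Strand i"] l(2)[of "Strand i" "Strand j"]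
      l(2)[of "Strand j" "Strand j"] h by auto
  have cong: "region l D i = region l' D i" for i
    using l(1) h(4) lc by (intro region_cong) (metis DiffI insertE singletonD)
  have "region l' D s = region l' D' s" for s
  proof (intro set_eqI)
    fix p
    have "p \<in> region l' D s \<longleftrightarrow>
        (\<exists>d. d \<noteq> Strand i \<and> d \<noteq> Strand j \<and> p \<in> points D d \<and> l' d = s) \<or>
        (p \<in> points D (Strand i) \<and> l' (Strand i) = s) \<or> (p \<in> points D (Strand j) \<and> l' (Strand j) = s)"
      unfolding region_def mem_Collect_eq by (rule ex_split_two)
    also have "\<dots> \<longleftrightarrow>
        (\<exists>d. d \<noteq> Strand i \<and> d \<noteq> Strand j \<and> p \<in> points D' d \<and> l' d = s) \<or>
        (p \<in> points D' (Strand i) \<and> l' (Strand i) = s) \<or> (p \<in> points D' (Strand j) \<and> l' (Strand j) = s)"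
      using lc(3) h(1,2,3) by (auto simp: h(6) points_def)
    also have "\<dots> \<longleftrightarrow> p \<in> region l' D' s"
      unfolding region_def mem_Collect_eq by (rule ex_split_two[symmetric])
    finally show "p \<in> region l' D s \<longleftrightarrow> p \<in> region l' D' s" .
  qed
  with cong show ?thesis
    by auto
qed

lemma components_saddle_split:
  assumes "saddle_split K K' D D'"
  shows "K \<subseteq> components D" "K' \<subseteq> components D'" "components D - K = components D' - K'"
    "Strand i \<in> K \<longleftrightarrow> Strand i \<in> K'"
proof -
  obtain c k u v w where h: "word D c = Some (u @ v @ w)" "Circle k \<notin> components D"
    "K = {c}" "K' = {c, Circle k}" "D' = D\<lparr>word := (word D)(c \<mapsto> u @ w, Circle k \<mapsto> v)\<rparr>"
    using assms unfolding saddle_split_def by blast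
  then have "components D' = insert (Circle k) (components D)"
    by (auto simp: components_def)
  then show "K \<subseteq> components D" "K' \<subseteq> components D'" "components D - K = components D' - K'"
    "Strand i \<in> K \<longleftrightarrow> Strand i \<in> K'"
    using h by (auto simp: components_def)
qed

lemma components_saddle_strands:
  assumes "saddle_strands K K' D D'"
  shows "K \<subseteq> components D" "K' \<subseteq> components D'" "components D - K = components D' - K'"
    "Strand i \<in> K \<longleftrightarrow> Strand i \<in> K'"
  using assms unfolding saddle_strands_def components_def by (auto split: if_splits)

text \<open>The last equivalence allows a strand to be followed through the band: the trace contains
  \<open>K \<times> K'\<close>, hence relates a strand that is cut to the strand of the same name
  afterwards.\<close>

lemma components_saddle:
  assumes "saddle K K' D D'"
  shows "K \<subseteq> components D" "K' \<subseteq> components D'" "components D - K = components D' - K'"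
    "Strand i \<in> K \<longleftrightarrow> Strand i \<in> K'"
proof -
  consider "saddle_split K K' D D'" | "saddle_split K' K D' D" | "saddle_strands K K' D D'"
    using assms unfolding saddle_def by blast
  then have "K \<subseteq> components D \<and> K' \<subseteq> components D' \<and>
      components D - K = components D' - K' \<and> (Strand i \<in> K \<longleftrightarrow> Strand i \<in> K')"
    by cases (simp_all add: components_saddle_split components_saddle_strands)
  then show "K \<subseteq> components D" "K' \<subseteq> components D'" "components D - K = components D' - K'"
    "Strand i \<in> K \<longleftrightarrow> Strand i \<in> K'"
    by blast+
qed

lemma region_saddle:
  assumes "saddle K K' D D'"
    and l: "\<And>c. c \<in> components D - K \<Longrightarrow> l c = l' c" "\<And>c c'. c \<in> K \<Longrightarrow> c' \<in> K' \<Longrightarrow> l c = l' c'"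
  shows "region l D = region l' D'"
  using assms(1) unfolding saddle_def
proof (elim disjE)
  assume s: "saddle_split K' K D' D"
  show ?thesis
  proof (rule region_saddle_split[OF s, symmetric])
    show "l' c = l c" if "c \<in> components D' - K'" for c
      using that l(1) components_saddle_split(3)[OF s] by metis
    show "l' c = l c'" if "c \<in> K'" "c' \<in> K" for c c'
      using that l(2) by metis
  qed
qed (rule region_saddle_split[OF _ l] region_saddle_strands[OF _ l], assumption+)+

text \<open>Here \<open>l\<close> and \<open>l'\<close> are the labels before and after the step.
  Agreement along \<open>R\<close> expresses that both are restrictions of one locally constant
  function on the surface.\<close>

lemma region_lk_cobordism_step:
  assumes "cobordism_step D R D'" and D: "gauss_diagram n D" and D': "gauss_diagram n D'"
    and l: "\<And>c c'. (c, c') \<in> R \<Longrightarrow> l c = l' c'" and "i \<noteq> j"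
  shows "region_lk l D i j = region_lk l' D' i j"
  using assms(1)
proof cases
  case (isomorphism g)
  then show ?thesis
    using l by (intro region_lk_isomorphism[OF D D']) auto
next
  case reidemeister
  have "region_lk l D = region_lk l' D"
    using l reidemeister by (intro region_lk_cong_region ext region_cong) auto
  then show ?thesis
    using region_lk_reidemeister[OF D D' reidemeister(2) \<open>i \<noteq> j\<close>] by metis
next
  case birth
  have "region l D = region l' D'"
    using l birth by (intro region_birth) auto
  moreover have "writhe D = writhe D'"
    using birth unfolding birth_def by auto
  ultimately show ?thesis
    by (metis region_lk_cong_region)
next
  case death
  have "region l' D' = region l D"
    using death(1) l by (intro region_birth[OF death(2)]) (metis Id_onI)
  moreover have "writhe D = writhe D'"
    using death unfolding birth_def by auto
  ultimately show ?thesis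
    by (metis region_lk_cong_region)
next
  case (saddle K K')
  have "region l D = region l' D'"
    using l saddle(1) by (intro region_saddle[OF saddle(2)]) auto
  moreover have "writhe D = writhe D'"
    using saddle(2) unfolding saddle_def saddle_split_def saddle_strands_def by auto
  ultimately show ?thesis
    by (metis region_lk_cong_region)
qed


section \<open>Linking numbers of string links\<close>

text \<open>The value on circles is a dummy: the function is used for diagrams without circles, and
  is overridden where an auxiliary circle occurs.\<close>

fun strand_label :: "component \<Rightarrow> nat" where
  "strand_label (Strand i) = i"
| "strand_label (Circle k) = 0"

lemma string_link_component:
  assumes "D \<in> string_link_diagrams n" "c \<in> components D"
  obtains i where "c = Strand i" "1 \<le> i" "i \<le> n"
  using assms unfolding string_link_diagrams_def gauss_diagram_def by (cases c) auto

lemma string_link_gauss: "D \<in> string_link_diagrams n \<Longrightarrow> gauss_diagram n D"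
  by (simp add: string_link_diagrams_def)

text \<open>A string link diagram has no circles, so the region of a label is a single strand. This
  converts labelled counts into linking numbers at the two ends of a movie.\<close>

lemma lk_eq_region_lk:
  assumes D: "D \<in> string_link_diagrams n" and l: "\<And>i. 1 \<le> i \<Longrightarrow> i \<le> n \<Longrightarrow> l (Strand i) = i"
  shows "lk D i j = region_lk l D i j"
proof -
  have "region l D i = on_strand D i" for i
  proof -
    have "l c = i \<longleftrightarrow> c = Strand i" if p: "p \<in> points D c" for p c i
    proof -
      obtain j where "c = Strand j" "1 \<le> j" "j \<le> n"
        using string_link_component[OF D points_component[OF p]] .
      then show ?thesis
        using l by simp
    qed
    then have "p \<in> region l D i \<longleftrightarrow> p \<in> points D (Strand i)" for p
      unfolding region_def mem_Collect_eq by metis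
    then show ?thesis
      by (auto simp: on_strand_def in_points_iff)
  qed
  then show ?thesis
    by (simp add: lk_def region_lk_def)
qed

text \<open>The index list of \<open>LK\<close>. Keeping it apart from the values reduces length and
  surjectivity to statements about a fixed list.\<close>

definition strand_pairs :: "nat \<Rightarrow> (nat \<times> nat) list" where
  "strand_pairs n = [(i, j). i \<leftarrow> [1..<Suc n], j \<leftarrow> [1..<Suc n], i \<noteq> j]"

lemma LK_eq_map: "LK n D = map (\<lambda>(i, j). lk D i j) (strand_pairs n)"
  by (simp add: LK_def strand_pairs_def map_concat comp_def if_distrib cong: if_cong del: upt_Suc)

lemma set_strand_pairs: "set (strand_pairs n) = {(i, j). i \<in> {1..n} \<and> j \<in> {1..n} \<and> i \<noteq> j}"
  by (auto simp: strand_pairs_def)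

lemma LK_eq_iff:
  "LK n D = LK n D' \<longleftrightarrow> (\<forall>i \<in> {1..n}. \<forall>j \<in> {1..n}. i \<noteq> j \<longrightarrow> lk D i j = lk D' i j)"
  unfolding LK_eq_map by (auto simp: set_strand_pairs)


section \<open>Cobordisms\<close>

abbreviation connection :: "component rel list \<Rightarrow> (nat \<times> component) rel" where
  "connection Rs \<equiv> (joined Rs \<union> (joined Rs)\<inverse>)\<^sup>*"

lemma equiv_connection: "equiv UNIV (connection Rs)"
  by (intro equivI refl_rtrancl sym_rtrancl trans_rtrancl) (auto simp: sym_Un_converse)

lemma connection_sym: "(x, y) \<in> connection Rs \<Longrightarrow> (y, x) \<in> connection Rs"
  using equiv_connection[of Rs] by (metis equivE symD)

text \<open>
  Instead of counting components: the initial strands lie in different components (witnessed by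
  the locally constant function \<open>l\<close>), and every slice is connected to one of them.
\<close>

definition tracked :: "nat \<Rightarrow> diagram list \<Rightarrow> component rel list \<Rightarrow> (nat \<times> component \<Rightarrow> nat) \<Rightarrow> bool" where
  "tracked n Ds Rs l \<longleftrightarrow>
     movie n Ds Rs \<and> hd Ds \<in> string_link_diagrams n \<and> last Ds \<in> string_link_diagrams n \<and>
     (\<forall>(x, y) \<in> joined Rs. l x = l y) \<and> (\<forall>i \<in> {1..n}. l (0, Strand i) = i) \<and>
     (\<forall>x \<in> slices Ds. \<exists>i \<in> {1..n}. ((0, Strand i), x) \<in> connection Rs)"

section \<open>Strands followed through a movie\<close>

lemma locally_constant_connection:
  assumes "\<forall>(x, y) \<in> joined Rs. l x = l y" "(x, y) \<in> connection Rs"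
  shows "l x = l y"
  using assms(2) by (induction rule: rtrancl_induct) (use assms(1) in fastforce)+

text \<open>Isomorphisms fix the labels of intervals, and a strand cut by a saddle is also one of
  the resulting components. So the name \<open>Strand i\<close> stays on one connected piece at all
  times, even if its terminal part is replaced.\<close>

lemma strand_persists_step:
  assumes "cobordism_step D R D'" "Strand i \<in> components D" "Strand i \<in> components D'"
  shows "(Strand i, Strand i) \<in> R"
  using assms(1)
proof cases
  case (isomorphism g)
  then have "g (Strand i) = Strand i"
    using assms(2) unfolding isomorphism_def components_def by blast
  then show ?thesis
    using isomorphism assms(2) by force
next
  case (saddle K K')
  then show ?thesis
    using assms components_saddle(4)[OF saddle(2), of i] by (cases "Strand i \<in> K") auto
qed (use assms in auto)

lemma cobordism_step_trace:
  assumes "cobordism_step D R D'"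
  shows "R \<subseteq> components D \<times> components D'"
  using assms
proof cases
  case (isomorphism g)
  then show ?thesis
    unfolding isomorphism_def by (auto simp: bij_betw_def)
next
  case reidemeister
  then show ?thesis
    using components_reidemeister by auto
next
  case (saddle K K')
  then show ?thesis
    using components_saddle[OF saddle(2)] by auto
qed (auto simp: birth_def components_def)

lemma joined_in_slices:
  assumes "movie n Ds Rs" "(x, y) \<in> joined Rs"
  shows "x \<in> slices Ds" "y \<in> slices Ds"
proof -
  obtain t c c' where "x = (t, c)" "y = (Suc t, c')" "t < length Rs" "(c, c') \<in> Rs ! t"
    using assms(2) unfolding joined_def by blast
  then show "x \<in> slices Ds" "y \<in> slices Ds"
    using assms(1) cobordism_step_trace[of "Ds ! t" "Rs ! t" "Ds ! Suc t"]
    unfolding movie_def slices_def by auto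
qed

lemma strand_in_movie:
  assumes "movie n Ds Rs" "i \<in> {1..n}" "t \<le> length Rs"
  shows "Strand i \<in> components (Ds ! t)"
  using assms unfolding movie_def gauss_diagram_def by (auto simp: nth_mem)

lemma strand_persists:
  assumes "movie n Ds Rs" "i \<in> {1..n}" "t \<le> length Rs"
  shows "((0, Strand i), (t, Strand i)) \<in> connection Rs"
  using assms(3)
proof (induction t)
  case (Suc t)
  have "(Strand i, Strand i) \<in> Rs ! t"
    using assms Suc.prems strand_in_movie[OF assms(1,2)] unfolding movie_def
    by (intro strand_persists_step[of "Ds ! t" _ "Ds ! Suc t"]) auto
  then have "((t, Strand i), (Suc t, Strand i)) \<in> joined Rs"
    using Suc.prems unfolding joined_def by auto
  then show ?case
    using Suc by (meson Suc_leD UnI1 rtrancl.rtrancl_into_rtrancl)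
qed simp

lemma strand_slice:
  assumes "movie n Ds Rs" "t \<le> length Rs"
  shows "(t, Strand i) \<in> slices Ds \<longleftrightarrow> i \<in> {1..n}"
  using assms unfolding movie_def gauss_diagram_def slices_def by (auto simp: nth_mem)

lemma equiv_slices: "equiv (slices Ds) (Restr (connection Rs) (slices Ds))"
  using equiv_connection[of Rs] unfolding equiv_def refl_on_def sym_def trans_def by blast

text \<open>Every connected piece contains exactly one initial strand; the number of that strand is
  the label of all slices in the piece.\<close>

lemma cobordism_tracked:
  assumes "cobordism n Ds Rs"
  shows "\<exists>l. tracked n Ds Rs l"
proof -
  let ?E = "Restr (connection Rs) (slices Ds)"
  have movie: "movie n Ds Rs" and ends: "hd Ds \<in> string_link_diagrams n" "last Ds \<in> string_link_diagrams n"
    and unique: "\<And>X. X \<in> surface_components Ds Rs \<Longrightarrow> \<exists>!i. (0, Strand i) \<in> X"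
    using assms by (simp_all add: cobordism_def)
  have ex1: "\<exists>!i. (x, (0, Strand i)) \<in> ?E" if "x \<in> slices Ds" for x
    using unique[of "?E `` {x}"] that unfolding surface_components_def by (simp add: quotientI)
  define l where "l x = (THE i. (x, (0, Strand i)) \<in> ?E)" for x
  have l: "(x, (0, Strand (l x))) \<in> ?E" if "x \<in> slices Ds" for x
    unfolding l_def by (rule theI') (rule ex1[OF that])
  have eq: "l x = i" if "x \<in> slices Ds" "(x, (0, Strand i)) \<in> ?E" for x i
    using ex1[OF that(1)] l[OF that(1)] that(2) by blast
  have "l x = l y" if "(x, y) \<in> joined Rs" for x y
  proof -
    have xy: "x \<in> slices Ds" "y \<in> slices Ds"
      using joined_in_slices[OF movie that] .
    moreover have "(x, y) \<in> connection Rs"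
      using that by blast
    ultimately have "(x, (0, Strand (l y))) \<in> ?E"
      using l[of y] by (auto intro: rtrancl_trans)
    then show ?thesis
      using eq xy by blast
  qed
  moreover have "l (0, Strand i) = i" if "i \<in> {1..n}" for i
    using strand_slice[OF movie, of 0 i] that by (intro eq) auto
  moreover have "\<exists>i \<in> {1..n}. ((0, Strand i), x) \<in> connection Rs" if "x \<in> slices Ds" for x
  proof
    have "(0, Strand (l x)) \<in> slices Ds"
      using l[OF that] by blast
    then show "l x \<in> {1..n}"
      using strand_slice[OF movie, of 0] by blast
    show "((0, Strand (l x)), x) \<in> connection Rs"
      using l[OF that] connection_sym by blast
  qed
  ultimately show ?thesis
    unfolding tracked_def using movie ends by blast
qed

text \<open>The pieces are the classes of the \<open>n\<close> initial strands, and \<open>l\<close>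
  keeps these classes apart. The condition at the final end follows because each strand is connected
  to its namesake at every later time.\<close>

lemma tracked_cobordism:
  assumes "tracked n Ds Rs l"
  shows "cobordism n Ds Rs"
proof -
  let ?E = "Restr (connection Rs) (slices Ds)"
  have movie: "movie n Ds Rs" and ends: "hd Ds \<in> string_link_diagrams n" "last Ds \<in> string_link_diagrams n"
    and l: "\<forall>(x, y) \<in> joined Rs. l x = l y" "\<And>i. i \<in> {1..n} \<Longrightarrow> l (0, Strand i) = i"
    and connected: "\<And>x. x \<in> slices Ds \<Longrightarrow> \<exists>i \<in> {1..n}. ((0, Strand i), x) \<in> connection Rs"
    using assms unfolding tracked_def by blast+
  have lc: "l x = l y" if "(x, y) \<in> connection Rs" for x y
    using locally_constant_connection[OF l(1) that] .
  have lt: "l (t, Strand i) = i" if "i \<in> {1..n}" "t \<le> length Rs" for t i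
    using lc[OF strand_persists[OF movie that]] l(2)[OF that(1)] by simp
  have S: "surface_components Ds Rs = (\<lambda>i. ?E `` {(0, Strand i)}) ` {1..n}"
  proof (intro set_eqI iffI)
    fix X assume "X \<in> surface_components Ds Rs"
    then obtain x where x: "x \<in> slices Ds" "X = ?E `` {x}"
      unfolding surface_components_def by (rule quotientE)
    obtain i where i: "i \<in> {1..n}" "((0, Strand i), x) \<in> connection Rs"
      using connected[OF x(1)] by blast
    then have "((0, Strand i), x) \<in> ?E"
      using x strand_slice[OF movie, of 0 i] by auto
    then have "X = ?E `` {(0, Strand i)}"
      unfolding x(2) using equiv_class_eq[OF equiv_slices] by metis
    then show "X \<in> (\<lambda>i. ?E `` {(0, Strand i)}) ` {1..n}"
      using i by blast
  next
    fix X assume "X \<in> (\<lambda>i. ?E `` {(0, Strand i)}) ` {1..n}"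
    then obtain i where i: "i \<in> {1..n}" "X = ?E `` {(0, Strand i)}"
      by blast
    then have "(0, Strand i) \<in> slices Ds"
      using strand_slice[OF movie, of 0 i] by simp
    then show "X \<in> surface_components Ds Rs"
      unfolding surface_components_def i(2) by (rule quotientI)
  qed
  \<comment> \<open>Stated for all times at once: \<open>t = 0\<close> gives injectivity of the
    classes and the initial condition, \<open>t = length Rs\<close> the final condition.\<close>
  have mem: "(t, Strand j) \<in> ?E `` {(0, Strand i)} \<longleftrightarrow> i = j" if "i \<in> {1..n}" "t \<le> length Rs" for i j t
  proof
    assume h: "(t, Strand j) \<in> ?E `` {(0, Strand i)}"
    then have "j \<in> {1..n}"
      using strand_slice[OF movie that(2)] by blast
    then show "i = j"
      using h lc[of "(0, Strand i)" "(t, Strand j)"] lt[of j t] that l(2) by simp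
  next
    assume "i = j"
    then show "(t, Strand j) \<in> ?E `` {(0, Strand i)}"
      using that(1) strand_persists[OF movie that] strand_slice[OF movie, of 0 i]
        strand_slice[OF movie that(2), of i]
      by simp
  qed
  have "inj_on (\<lambda>i. ?E `` {(0, Strand i)}) {1..n}"
  proof (rule inj_onI)
    fix i j assume ij: "i \<in> {1..n}" "j \<in> {1..n}" "?E `` {(0, Strand i)} = ?E `` {(0, Strand j)}"
    have "(0, Strand i) \<in> ?E `` {(0, Strand i)}"
      using mem[OF ij(1), of 0 i] by blast
    then have "(0, Strand i) \<in> ?E `` {(0, Strand j)}"
      using ij(3) by blast
    then show "i = j"
      using mem[OF ij(2), of 0 i] by blast
  qed
  then have "card (surface_components Ds Rs) = n"
    unfolding S by (simp add: card_image)
  moreover have "(\<exists>!i. (0, Strand i) \<in> X) \<and> (\<exists>!i. (length Rs, Strand i) \<in> X)"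
    if X: "X \<in> surface_components Ds Rs" for X
  proof -
    obtain i where i: "i \<in> {1..n}" "X = ?E `` {(0, Strand i)}"
      using X unfolding S by blast
    have "(t, Strand j) \<in> X \<longleftrightarrow> j = i" if "t \<le> length Rs" for t j
      using mem[OF i(1) that, of j] i(2) by blast
    then show ?thesis
      by simp
  qed
  ultimately show ?thesis
    unfolding cobordism_def using movie ends by (intro conjI ballI) simp_all
qed

lemma cobordant_iff:
  "(D, D') \<in> cobordant n \<longleftrightarrow> (\<exists>Ds Rs l. tracked n Ds Rs l \<and> hd Ds = D \<and> last Ds = D')"
  unfolding cobordant_def using cobordism_tracked tracked_cobordism by blast

lemma lk_cobordant:
  assumes "(D, D') \<in> cobordant n" "i \<noteq> j"
  shows "lk D i j = lk D' i j"
proof -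
  obtain Ds Rs l where T: "tracked n Ds Rs l" and D: "hd Ds = D" "last Ds = D'"
    using assms(1) unfolding cobordant_iff by blast
  have movie: "movie n Ds Rs" and l: "\<forall>(x, y) \<in> joined Rs. l x = l y"
      "\<And>i. i \<in> {1..n} \<Longrightarrow> l (0, Strand i) = i"
    and SL: "D \<in> string_link_diagrams n" "D' \<in> string_link_diagrams n"
    using T D unfolding tracked_def by blast+
  have lt: "l (t, Strand i) = i" if "i \<in> {1..n}" "t \<le> length Rs" for t i
    using locally_constant_connection[OF l(1) strand_persists[OF movie that]] l(2)[OF that(1)] by simp
  \<comment> \<open>Circles may be present in between, so the induction over time runs on labelled
    counts, and linking numbers appear only at the two ends.\<close>
  have "region_lk (\<lambda>c. l (0, c)) (Ds ! 0) i j = region_lk (\<lambda>c. l (t, c)) (Ds ! t) i j"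
    if "t \<le> length Rs" for t
    using that
  proof (induction t)
    case (Suc t)
    have "region_lk (\<lambda>c. l (t, c)) (Ds ! t) i j = region_lk (\<lambda>c. l (Suc t, c)) (Ds ! Suc t) i j"
    proof (rule region_lk_cobordism_step[of _ "Rs ! t"])
      show "cobordism_step (Ds ! t) (Rs ! t) (Ds ! Suc t)"
        "gauss_diagram n (Ds ! t)" "gauss_diagram n (Ds ! Suc t)"
        using movie Suc.prems unfolding movie_def by auto
      show "l (t, c) = l (Suc t, c')" if "(c, c') \<in> Rs ! t" for c c'
        using l(1) that Suc.prems unfolding joined_def by fastforce
    qed fact
    then show ?case
      using Suc by simp
  qed simp
  moreover have "Ds ! 0 = D" "Ds ! length Rs = D'"
    using movie D unfolding movie_def
    by (metis hd_conv_nth length_0_conv nat.distinct(1), metis diff_Suc_1 last_conv_nth length_0_conv nat.distinct(1))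
  ultimately show ?thesis
    using le_refl[of "length Rs"] lk_eq_region_lk[OF SL(1), of "\<lambda>c. l (0, c)" i j]
      lk_eq_region_lk[OF SL(2), of "\<lambda>c. l (length Rs, c)" i j] lt
    by (metis atLeastAtMost_iff le0)
qed

section \<open>Cobordism as a reflexive and transitive relation\<close>

lemma cobordant_string_link:
  "(D, D') \<in> cobordant n \<Longrightarrow> D \<in> string_link_diagrams n \<and> D' \<in> string_link_diagrams n"
  unfolding cobordant_def cobordism_def by blast

lemma cobordant_refl:
  assumes "D \<in> string_link_diagrams n"
  shows "(D, D) \<in> cobordant n"
proof -
  have "tracked n [D] [] (\<lambda>(t, c). strand_label c)"
    using assms unfolding tracked_def movie_def
    by (auto simp: joined_def slices_def string_link_gauss elim!: string_link_component[OF assms])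
  then show ?thesis
    unfolding cobordant_iff by (metis last.simps list.sel(1))
qed

text \<open>With no circles at either end and a trace inside the identity, the strand number itself
  is a locally constant label.\<close>

lemma cobordant_step:
  assumes D: "D \<in> string_link_diagrams n" and D': "D' \<in> string_link_diagrams n"
    and step: "cobordism_step D R D'" and R: "\<And>c c'. (c, c') \<in> R \<Longrightarrow> c = c'"
  shows "(D, D') \<in> cobordant n"
proof -
  have movie: "movie n [D, D'] [R]"
    using D D' step by (simp add: movie_def string_link_gauss)
  have "\<exists>i \<in> {1..n}. ((0, Strand i), x) \<in> connection [R]" if x: "x \<in> slices [D, D']" for x
  proof -
    obtain t c where tc: "x = (t, c)" "t \<le> 1" "c \<in> components ([D, D'] ! t)"
      using x unfolding slices_def by auto
    then obtain i where "c = Strand i" "i \<in> {1..n}"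
      using string_link_component[OF D] string_link_component[OF D']
      by (cases t) (auto, (metis atLeastAtMost_iff One_nat_def)+)
    then show ?thesis
      using strand_persists[OF movie, of i t] tc by auto
  qed
  then have "tracked n [D, D'] [R] (\<lambda>(t, c). strand_label c)"
    using D D' movie R unfolding tracked_def by (auto simp: joined_def)
  then show ?thesis
    unfolding cobordant_iff by (metis last.simps list.distinct(1) list.sel(1))
qed

text \<open>The labellings of the two movies fit together at \<open>D2\<close>: all components there
  are strands, and by persistence the first labelling gives \<open>Strand i\<close> the value
  \<open>i\<close>, which is where the second one starts.\<close>

lemma cobordant_trans:
  assumes "(D1, D2) \<in> cobordant n" "(D2, D3) \<in> cobordant n"
  shows "(D1, D3) \<in> cobordant n"
proof -
  obtain Ds Rs l where T: "tracked n Ds Rs l" and D: "hd Ds = D1" "last Ds = D2"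
    using assms(1) unfolding cobordant_iff by blast
  obtain Ds' Rs' l' where T': "tracked n Ds' Rs' l'" and D': "hd Ds' = D2" "last Ds' = D3"
    using assms(2) unfolding cobordant_iff by blast
  let ?m = "length Rs"
  have movie: "movie n Ds Rs" and l: "\<forall>(x, y) \<in> joined Rs. l x = l y"
      "\<And>i. i \<in> {1..n} \<Longrightarrow> l (0, Strand i) = i"
    and conn: "\<And>x. x \<in> slices Ds \<Longrightarrow> \<exists>i \<in> {1..n}. ((0, Strand i), x) \<in> connection Rs"
    and SL: "D1 \<in> string_link_diagrams n" "D2 \<in> string_link_diagrams n"
    using T D unfolding tracked_def by blast+
  have movie': "movie n Ds' Rs'" and l': "\<forall>(x, y) \<in> joined Rs'. l' x = l' y"
      "\<And>i. i \<in> {1..n} \<Longrightarrow> l' (0, Strand i) = i"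
    and conn': "\<And>x. x \<in> slices Ds' \<Longrightarrow> \<exists>i \<in> {1..n}. ((0, Strand i), x) \<in> connection Rs'"
    and SL': "D3 \<in> string_link_diagrams n"
    using T' D' unfolding tracked_def by blast+
  have len: "length Ds = Suc ?m" "length Ds' = Suc (length Rs')"
    using movie movie' unfolding movie_def by auto
  have glue: "Ds ! ?m = D2" "Ds' ! 0 = D2"
    using len D D' by (metis diff_Suc_1 last_conv_nth length_0_conv nat.distinct(1), 
        metis hd_conv_nth length_0_conv nat.distinct(1))
  \<comment> \<open>The common diagram \<open>D2\<close> is kept once, so time \<open>t\<close> of
    the second movie becomes time \<open>length Rs + t\<close>.\<close>
  define Es where "Es = Ds @ tl Ds'"
  define Qs where "Qs = Rs @ Rs'"
  have Es1: "Es ! t = Ds ! t" if "t \<le> ?m" for t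
    using that len by (simp add: Es_def nth_append)
  have Es2: "Es ! (?m + t) = Ds' ! t" if "t \<le> length Rs'" for t
  proof (cases t)
    case 0
    then show ?thesis using Es1[of ?m] glue by simp
  next
    case (Suc s)
    then show ?thesis
      using that len by (simp add: Es_def nth_append nth_tl)
  qed
  have lenE: "length Es = Suc (length Qs)"
    using len by (simp add: Es_def Qs_def)
  have movieE: "movie n Es Qs"
    unfolding movie_def
  proof (intro conjI ballI allI impI)
    show "gauss_diagram n D" if "D \<in> set Es" for D
    proof -
      have "D \<in> set Ds \<union> set Ds'"
        using that by (cases Ds') (auto simp: Es_def)
      then show ?thesis
        using movie movie' unfolding movie_def by blast
    qed
    show "cobordism_step (Es ! t) (Qs ! t) (Es ! Suc t)" if "t < length Qs" for t
    proof (cases "t < ?m")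
      case True
      then show ?thesis
        using movie Es1[of t] Es1[of "Suc t"] unfolding movie_def by (simp add: Qs_def nth_append)
    next
      case False
      then obtain s where s: "t = ?m + s"
        using le_Suc_ex by (metis not_less)
      then show ?thesis
        using movie' Es2[of s] Es2[of "Suc s"] that unfolding movie_def
        by (simp add: Qs_def nth_append)
    qed
  qed (fact lenE)
  have ne: "Ds \<noteq> []" "Ds' \<noteq> []"
    using len by auto
  have endsE: "hd Es = D1" "last Es = D3"
    using ne D D' by (auto simp: Es_def last_append last_tl) (metis hd_Cons_tl last_ConsL)
  \<comment> \<open>At the junction the first labelling is used; hence only the first step of the
    second movie mixes the two.\<close>
  define lE where "lE = (\<lambda>(t, c). if t \<le> ?m then l (t, c) else l' (t - ?m, c))"
  have junction: "l (?m, c) = l' (0, c)" if "c \<in> components D2" for c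
  proof -
    obtain i where i: "c = Strand i" "i \<in> {1..n}"
      using string_link_component[OF SL(2) \<open>c \<in> components D2\<close>] by (metis atLeastAtMost_iff)
    then show ?thesis
      using locally_constant_connection[OF l(1) strand_persists[OF movie i(2), of ?m]] l(2) l'(2) by simp
  qed
  have "lE x = lE y" if xy: "(x, y) \<in> joined Qs" for x y
  proof -
    obtain t c c' where t: "x = (t, c)" "y = (Suc t, c')" "t < length Qs" "(c, c') \<in> Qs ! t"
      using xy unfolding joined_def by blast
    show ?thesis
    proof (cases "t < ?m")
      case True
      then have "((t, c), (Suc t, c')) \<in> joined Rs"
        using t unfolding joined_def Qs_def by (auto simp: nth_append)
      then show ?thesis
        using l(1) True t by (auto simp: lE_def)
    next
      case False
      then obtain s where s: "t = ?m + s"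
        using le_Suc_ex by (metis not_less)
      then have j: "((s, c), (Suc s, c')) \<in> joined Rs'"
        using t unfolding joined_def Qs_def by (auto simp: nth_append)
      then have "(s, c) \<in> slices Ds'"
        using joined_in_slices[OF movie'] by blast
      then have "l (?m, c) = l' (0, c)" if "s = 0"
        using junction glue that by (auto simp: slices_def)
      then show ?thesis
        using l'(1) j t s by (cases s) (auto simp: lE_def)
    qed
  qed
  moreover have "lE (0, Strand i) = i" if "i \<in> {1..n}" for i
    using l(2)[OF that] by (simp add: lE_def)
  moreover have "\<exists>i \<in> {1..n}. ((0, Strand i), x) \<in> connection Qs" if "x \<in> slices Es" for x
  proof -
    obtain t c where t: "x = (t, c)" "t \<le> length Qs" "c \<in> components (Es ! t)"
      using \<open>x \<in> slices Es\<close> lenE unfolding slices_def by auto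
    show ?thesis
    proof (cases "t \<le> ?m")
      case True
      then have "x \<in> slices Ds"
        using t Es1 len by (simp add: slices_def)
      moreover have "joined Rs \<subseteq> joined Qs"
        unfolding joined_def Qs_def by (auto simp: nth_append)
      then have "connection Rs \<subseteq> connection Qs"
        by (intro rtrancl_mono) blast
      ultimately show ?thesis
        using conn by blast
    next
      case False
      then obtain s where s: "t = ?m + s"
        by (metis le_Suc_ex nat_le_linear)
      then have "(s, c) \<in> slices Ds'"
        using t Es2[of s] len by (simp add: slices_def Qs_def)
      then obtain i where i: "i \<in> {1..n}" "((0, Strand i), (s, c)) \<in> connection Rs'"
        using conn' by blast
      \<comment> \<open>The time shift embeds the second surface. A late slice is connected to a
        strand of \<open>D2\<close> there, and that strand leads back to time 0 by
        persistence.\<close>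
      define sh :: "nat \<times> component \<Rightarrow> nat \<times> component" where "sh = (\<lambda>(t, c). (?m + t, c))"
      have "(sh y, sh z) \<in> joined Qs" if "(y, z) \<in> joined Rs'" for y z
        using that unfolding joined_def Qs_def sh_def by (force simp: nth_append)
      then have shift: "(sh y, sh z) \<in> joined Qs \<union> (joined Qs)\<inverse>" if "(y, z) \<in> joined Rs' \<union> (joined Rs')\<inverse>" for y z
        using that by blast
      have "(sh y, sh z) \<in> connection Qs" if "(y, z) \<in> connection Rs'" for y z
        using that
      proof (induction rule: rtrancl_induct)
        case (step z z')
        then show ?case
          using shift by (meson rtrancl.rtrancl_into_rtrancl)
      qed simp
      then have "((?m, Strand i), (t, c)) \<in> connection Qs"
        using i(2) s unfolding sh_def by fastforce
      moreover have "((0, Strand i), (?m, Strand i)) \<in> connection Qs"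
        by (rule strand_persists[OF movieE i(1)]) (simp add: Qs_def)
      ultimately show ?thesis
        using i(1) t(1) by (meson rtrancl_trans)
    qed
  qed
  ultimately have "tracked n Es Qs lE"
    unfolding tracked_def using movieE endsE SL SL' by blast
  then show ?thesis
    unfolding cobordant_iff using endsE by blast
qed


section \<open>Exchanges of neighbouring endpoints as cobordisms\<close>

lemma exchange_commute: "exchange p q D = exchange q p D"
  by (simp add: exchange_def transpose_commute)

lemma exchange_exchange [simp]: "exchange p q (exchange p q D) = D"
  by (simp add: exchange_def option.map_comp comp_def option.map_ident)

text \<open>\<open>exchange\<close> renames endpoints throughout the diagram. Since each endpoint
  occurs only once, this amounts to swapping two neighbours in a single word.\<close>

lemma exchange_neighbours:
  assumes D: "gauss_diagram n D" and w: "word D c = Some (u @ [p, q] @ v)"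
  shows "exchange p q D = D\<lparr>word := (word D)(c \<mapsto> u @ [q, p] @ v)\<rparr>"
proof -
  have d: "distinct (u @ [p, q] @ v)"
    using gauss_diagramD(3)[OF D w] .
  have "word (exchange p q D) c' = ((word D)(c \<mapsto> u @ [q, p] @ v)) c'" for c'
  proof (cases "c' = c")
    case True
    have "map (Transposition.transpose p q) x = x" if "p \<notin> set x" "q \<notin> set x" for x
      using that by (intro map_idI transpose_apply_other) auto
    then show ?thesis
      using True w d by simp
  next
    case False
    have "Transposition.transpose p q r = r" if "word D c' = Some w'" "r \<in> set w'" for w' r
    proof (rule transpose_apply_other)
      show "r \<noteq> p" "r \<noteq> q"
        using gauss_diagramD(4)[OF D, of _ c c'] False that w by auto
    qed
    then show ?thesis
      using False by (cases "word D c'") (auto intro!: map_idI)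
  qed
  then show ?thesis
    by (intro diagram.equality) (auto simp: exchange_def)
qed

lemma string_link_exchange:
  assumes "D \<in> string_link_diagrams n" "p \<in> endpoints D" "q \<in> endpoints D"
  shows "exchange p q D \<in> string_link_diagrams n"
  using assms gauss_diagram_exchange unfolding string_link_diagrams_def by simp

lemma adjacent_endpoints:
  assumes "adjacent D p q"
  shows "p \<in> endpoints D" "q \<in> endpoints D"
  by (rule adjacent_same_component[OF assms]; simp add: endpoints_eq; blast)+

lemma string_link_follows:
  assumes "D \<in> string_link_diagrams n" "follows D p q"
  obtains i u v where "i \<in> {1..n}" "word D (Strand i) = Some (u @ [p, q] @ v)"
proof -
  have "\<not> (\<exists>k u. word D (Circle k) = Some ([q] @ u @ [p]))"
    using assms(1) unfolding string_link_diagrams_def components_def by blast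
  then obtain c u v where w: "word D c = Some (u @ [p, q] @ v)"
    using assms(2) unfolding follows_def by blast
  moreover from this have "c \<in> components D"
    by (auto simp: components_def)
  ultimately show ?thesis
    using string_link_component[OF assms(1)] that by (metis atLeastAtMost_iff)
qed

text \<open>One endpoint is split off on a circle of its own, which is merged again on the other side.\<close>

lemma cobordant_exchange_follows:
  assumes D: "D \<in> string_link_diagrams n" and "follows D p q"
  shows "(D, exchange p q D) \<in> cobordant n"
proof -
  obtain i u v where i: "i \<in> {1..n}" and w: "word D (Strand i) = Some (u @ [p, q] @ v)"
    using string_link_follows[OF assms] .
  note G = string_link_gauss[OF D]
  define D2 where "D2 = exchange p q D"
  have D2: "D2 \<in> string_link_diagrams n"
    unfolding D2_def using w by (intro string_link_exchange[OF D]) (auto simp: in_endpoints_iff intro!: exI[of _ "Strand i"])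
  have D2_eq: "D2 = D\<lparr>word := (word D)(Strand i \<mapsto> u @ [q, p] @ v)\<rparr>"
    unfolding D2_def by (rule exchange_neighbours[OF G w])
  \<comment> \<open>With \<open>p\<close> removed, the words \<open>u @ [p, q] @ v\<close> and
    \<open>u @ [q, p] @ v\<close> coincide, so \<open>D1\<close> arises from both ends of the
    cobordism by splitting off \<open>p\<close>.\<close>
  define D1 where "D1 = D\<lparr>word := (word D)(Strand i \<mapsto> u @ [q] @ v, Circle 0 \<mapsto> [p])\<rparr>"
  have d: "distinct (u @ [p, q] @ v)"
    using gauss_diagramD(3)[OF G w] .
  have C: "Circle 0 \<notin> components D" "Circle 0 \<notin> components D2"
    using D D2 unfolding string_link_diagrams_def by blast+
  have comps: "components D1 = insert (Circle 0) (components D)" "components D2 = components D"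
    using w by (auto simp: D1_def D2_def components_def)
  have points1: "points D1 c = (if c = Strand i then points D c - {p} else if c = Circle 0 then {p} else points D c)" for c
    using d w by (auto simp: points_def D1_def)
  have p: "p \<in> points D (Strand i)"
    using w by simp
  have ends: "endpoints D1 = endpoints D"
  proof (intro set_eqI iffI)
    fix r assume "r \<in> endpoints D1"
    then show "r \<in> endpoints D"
      using p unfolding endpoints_eq by (auto simp: points1 split: if_splits)
  next
    fix r assume "r \<in> endpoints D"
    then obtain c where c: "r \<in> points D c"
      unfolding endpoints_eq by blast
    then have "c \<noteq> Circle 0"
      using C points_component by blast
    then have "r \<in> points D1 c \<or> r \<in> points D1 (Circle 0)"
      using c by (auto simp: points1)
    then show "r \<in> endpoints D1"
      unfolding endpoints_eq by blast
  qed
  have D1: "gauss_diagram n D1"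
  proof (rule gauss_diagramI)
    show "distinct w'" if "word D1 c = Some w'" for c w'
      using that d gauss_diagramD(3)[OF G] by (auto simp: D1_def split: if_splits)
    show "c = c'" if "r \<in> points D1 c" "r \<in> points D1 c'" for r c c'
      using that gauss_diagramD(4)[OF G] p by (auto simp: points1 split: if_splits)
    show "writhe D1 a = 1 \<or> writhe D1 a = - 1" if "a \<in> arrows D1" for a
      using that gauss_diagramD(6)[OF G, of a] ends by (simp add: arrows_def D1_def)
  qed (use gauss_diagramD[OF G] in \<open>simp_all add: comps ends\<close>)
  let ?K = "{Strand i}" and ?K' = "{Strand i, Circle 0}"
  have "saddle_split ?K ?K' D D1"
    unfolding saddle_split_def using w C
    by (intro exI[of _ "Strand i"] exI[of _ 0] exI[of _ u] exI[of _ "[p]"] exI[of _ "[q] @ v"])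
      (simp add: D1_def)
  then have step1: "cobordism_step D (Id_on (components D - ?K) \<union> ?K \<times> ?K') D1"
    by (intro cobordism_step.saddle) (simp add: saddle_def)
  \<comment> \<open>The second saddle is this split read backwards.\<close>
  have "saddle_split ?K ?K' D2 D1"
    unfolding saddle_split_def using C
    by (intro exI[of _ "Strand i"] exI[of _ 0] exI[of _ "u @ [q]"] exI[of _ "[p]"] exI[of _ v])
      (simp add: D1_def D2_eq)
  then have step2: "cobordism_step D1 (Id_on (components D1 - ?K') \<union> ?K' \<times> ?K) D2"
    by (intro cobordism_step.saddle) (simp add: saddle_def)
  let ?Ds = "[D, D1, D2]"
  let ?Rs = "[Id_on (components D - ?K) \<union> ?K \<times> ?K', Id_on (components D1 - ?K') \<union> ?K' \<times> ?K]"
  \<comment> \<open>The auxiliary circle lies on the same piece of the surface as the strand from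
    which it was split.\<close>
  define l where "l = (\<lambda>(t :: nat, c). if c = Circle 0 then i else strand_label c)"
  have movie: "movie n ?Ds ?Rs"
    unfolding movie_def using step1 step2 G D1 string_link_gauss[OF D2]
    by (auto simp: less_Suc_eq)
  have "l x = l y" if "(x, y) \<in> joined ?Rs" for x y
  proof -
    obtain t c c' where t: "x = (t, c)" "y = (Suc t, c')" "t < 2" "(c, c') \<in> ?Rs ! t"
      using \<open>(x, y) \<in> joined ?Rs\<close> unfolding joined_def by auto
    then have "c = c' \<or> c \<in> ?K' \<and> c' \<in> ?K'"
      by (auto simp: less_2_cases_iff)
    then show ?thesis
      using t by (auto simp: l_def)
  qed
  moreover have "l (0, Strand j) = j" for j
    by (simp add: l_def)
  moreover have "\<exists>j \<in> {1..n}. ((0, Strand j), x) \<in> connection ?Rs" if "x \<in> slices ?Ds" for x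
  proof -
    obtain t c where t: "x = (t, c)" "t \<le> 2" "c \<in> components (?Ds ! t)"
      using \<open>x \<in> slices ?Ds\<close> unfolding slices_def by auto
    then have "c \<in> components D \<or> t = 1 \<and> c = Circle 0"
      using comps by (auto simp: le_Suc_eq numeral_2_eq_2)
    then show ?thesis
    proof
      assume "c \<in> components D"
      then obtain j where "c = Strand j" "j \<in> {1..n}"
        using string_link_component[OF D] by (metis atLeastAtMost_iff)
      then show ?thesis
        using strand_persists[OF movie, of j t] t by auto
    next
      assume h: "t = 1 \<and> c = Circle 0"
      have "((0, Strand i), (1, Circle 0)) \<in> joined ?Rs"
        unfolding joined_def by auto
      then have "((0, Strand i), x) \<in> connection ?Rs"
        using h t(1) by blast
      then show ?thesis
        using i by blast
    qed
  qed
  ultimately have "tracked n ?Ds ?Rs l"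
    unfolding tracked_def using movie D D2 by auto
  moreover have "hd ?Ds = D" "last ?Ds = D2"
    by simp_all
  ultimately show ?thesis
    unfolding cobordant_iff D2_def[symmetric] by blast
qed

lemma cobordant_exchange:
  assumes D: "D \<in> string_link_diagrams n" and adj: "adjacent D p q"
  shows "(D, exchange p q D) \<in> cobordant n"
  using adj cobordant_exchange_follows[OF D, of p q] cobordant_exchange_follows[OF D, of q p]
  unfolding adjacent_def by (metis exchange_commute)

lemma follows_exchange:
  assumes "follows D r s"
  shows "follows (exchange p q D) (Transposition.transpose p q r) (Transposition.transpose p q s)"
  using assms unfolding follows_def
proof (elim disjE exE)
  let ?t = "Transposition.transpose p q"
  fix c u v assume "word D c = Some (u @ [r, s] @ v)"
  then have "word (exchange p q D) c = Some (map ?t u @ [?t r, ?t s] @ map ?t v)"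
    by simp
  then show "(\<exists>c u v. word (exchange p q D) c = Some (u @ [?t r, ?t s] @ v)) \<or>
      (\<exists>k u. word (exchange p q D) (Circle k) = Some ([?t s] @ u @ [?t r]))"
    by blast
next
  let ?t = "Transposition.transpose p q"
  fix k u assume "word D (Circle k) = Some ([s] @ u @ [r])"
  then have "word (exchange p q D) (Circle k) = Some ([?t s] @ map ?t u @ [?t r])"
    by simp
  then show "(\<exists>c u v. word (exchange p q D) c = Some (u @ [?t r, ?t s] @ v)) \<or>
      (\<exists>k u. word (exchange p q D) (Circle k) = Some ([?t s] @ u @ [?t r]))"
    by blast
qed

lemma adjacent_exchange:
  "adjacent D r s \<Longrightarrow>
    adjacent (exchange p q D) (Transposition.transpose p q r) (Transposition.transpose p q s)"
  unfolding adjacent_def using follows_exchange by blast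

lemma cobordant_exchange_sym:
  assumes D: "exchange p q D \<in> string_link_diagrams n" and adj: "adjacent D p q"
  shows "(exchange p q D, D) \<in> cobordant n"
proof -
  have "adjacent (exchange p q D) q p"
    using adjacent_exchange[OF adj, of p q] by simp
  then have "(exchange p q D, exchange q p (exchange p q D)) \<in> cobordant n"
    by (rule cobordant_exchange[OF D])
  then show ?thesis
    by (simp add: exchange_commute[of q p])
qed

section \<open>Unwelded moves as cobordisms\<close>

lemma cobordant_reidemeister:
  assumes "D \<in> string_link_diagrams n" "D' \<in> string_link_diagrams n" "reidemeister D D'"
  shows "(D, D') \<in> cobordant n"
  by (rule cobordant_step[OF assms(1,2) cobordism_step.reidemeister[OF assms(3)]]) auto

lemma isomorphism_fixes_strands:
  assumes "D \<in> string_link_diagrams n" "isomorphism g D D'" "c \<in> components D"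
  shows "g c = c"
proof -
  obtain i where i: "c = Strand i"
    using string_link_component[OF assms(1,3)] by blast
  moreover obtain w where "word D c = Some w"
    using assms(3) unfolding components_def by blast
  ultimately show ?thesis
    using assms(2) unfolding isomorphism_def by blast
qed

lemma cobordant_isomorphism:
  assumes D: "D \<in> string_link_diagrams n" "D' \<in> string_link_diagrams n" and g: "isomorphism g D D'"
  shows "(D, D') \<in> cobordant n"
  by (rule cobordant_step[OF D cobordism_step.isomorphism[OF g]])
    (auto simp: isomorphism_fixes_strands[OF D(1) g])

lemma isomorphism_string_linkI:
  assumes D: "D \<in> string_link_diagrams n" and D': "D' \<in> string_link_diagrams n"
    and f: "inj_on f (arrows D)" "\<And>a. a \<in> arrows D \<Longrightarrow> writhe D' (f a) = writhe D a"
    and w: "\<And>i. i \<in> {1..n} \<Longrightarrow>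
      the (word D' (Strand i)) = map (map_endpoint f) (the (word D (Strand i)))"
  shows "isomorphism id D D'"
proof -
  have comps: "components E = Strand ` {1..n}" if "E \<in> string_link_diagrams n" for E
    using that string_link_component[OF that] gauss_diagramD(2)[OF string_link_gauss[OF that]]
    by (auto simp: image_iff) (metis atLeastAtMost_iff)
  have "word D' (Strand i) = Some (map (map_endpoint f) v)" if v: "word D (Strand i) = Some v" for i v
  proof -
    have "Strand i \<in> components D"
      using v by (auto simp: components_def)
    then have "i \<in> {1..n}" "Strand i \<in> components D'"
      using comps[OF D] comps[OF D'] by auto
    then show ?thesis
      using w[of i] v by (auto simp: components_def)
  qed
  moreover have "word D (Circle k) = None" for k
    using D unfolding string_link_diagrams_def components_def by blast
  ultimately show ?thesis
    unfolding isomorphism_def comps[OF D] comps[OF D'] using f by auto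
qed

text \<open>The definition of \<open>isomorphism\<close> asks \<open>f\<close> to be injective but
  does not mention surjectivity. That \<open>f\<close> reaches every arrow of \<open>D'\<close>
  follows since each word of \<open>D'\<close> is the image of a word of \<open>D\<close>; then
  \<open>f\<close> can be inverted.\<close>

lemma isomorphism_string_link_sym:
  assumes D: "D \<in> string_link_diagrams n" and D': "D' \<in> string_link_diagrams n"
    and g: "isomorphism g D D'"
  shows "isomorphism id D' D"
proof -
  obtain f where f: "inj_on f (arrows D)" "\<And>a. a \<in> arrows D \<Longrightarrow> writhe D' (f a) = writhe D a"
    "\<And>i w. word D (Strand i) = Some w \<Longrightarrow> word D' (Strand i) = Some (map (map_endpoint f) w)"
    using g unfolding isomorphism_def by blast
  let ?h = "inv_into (arrows D) f"
  have strand: "\<exists>w. word D (Strand i) = Some w \<and> word D' (Strand i) = Some (map (map_endpoint f) w)"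
    if "i \<in> {1..n}" for i
    using that f(3) gauss_diagramD(2)[OF string_link_gauss[OF D], of i]
    by (auto simp: components_def)
  have arrows: "arrows D' = f ` arrows D"
  proof (intro set_eqI iffI)
    fix a assume "a \<in> arrows D'"
    then obtain c w' where w': "word D' c = Some w'" "Tail a \<in> set w'"
      unfolding arrows_def in_endpoints_iff by blast
    then have "c \<in> components D'"
      by (auto simp: components_def)
    then obtain i where i: "c = Strand i" "i \<in> {1..n}"
      using string_link_component[OF D'] by (metis atLeastAtMost_iff)
    obtain w where w: "word D (Strand i) = Some w" "w' = map (map_endpoint f) w"
      using strand[OF i(2)] w' i by auto
    then obtain r where r: "r \<in> set w" "Tail a = map_endpoint f r"
      using w' by auto
    obtain b where "r = Tail b" "a = f b"
      using r(2) by (cases r) auto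
    then show "a \<in> f ` arrows D"
      using r w unfolding arrows_def in_endpoints_iff by blast
  next
    fix a assume "a \<in> f ` arrows D"
    then obtain b where b: "a = f b" "Tail b \<in> endpoints D"
      unfolding arrows_def by blast
    then obtain c w where w: "word D c = Some w" "Tail b \<in> set w"
      unfolding in_endpoints_iff by blast
    then have "c \<in> components D"
      by (auto simp: components_def)
    then obtain i where "c = Strand i"
      using string_link_component[OF D] by metis
    then have "word D' c = Some (map (map_endpoint f) w)"
      using w f(3) by blast
    moreover have "Tail a \<in> set (map (map_endpoint f) w)"
      using w(2) b(1) by force
    ultimately show "a \<in> arrows D'"
      unfolding arrows_def in_endpoints_iff by blast
  qed
  have h: "?h (f a) = a" if "a \<in> arrows D" for a
    using that f(1) by simp
  show ?thesis
  proof (rule isomorphism_string_linkI[OF D' D])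
    show "inj_on ?h (arrows D')"
      unfolding arrows by (intro inj_on_inv_into) simp
    show "writhe D (?h a) = writhe D' a" if "a \<in> arrows D'" for a
      using that f(2) h unfolding arrows by auto
    fix i assume "i \<in> {1..n}"
    then obtain w where w: "word D (Strand i) = Some w" "word D' (Strand i) = Some (map (map_endpoint f) w)"
      using strand by blast
    have "map_endpoint ?h (map_endpoint f r) = r" if r: "r \<in> set w" for r
    proof -
      have "r \<in> endpoints D"
        using r w unfolding in_endpoints_iff by blast
      then show ?thesis
        using h arrows_iff_Head[OF string_link_gauss[OF D]] by (cases r) (auto simp: arrows_def)
    qed
    then have "map (map_endpoint ?h) (map (map_endpoint f) w) = w"
      unfolding map_map by (intro map_idI) simp
    then show "the (word D (Strand i)) = map (map_endpoint ?h) (the (word D' (Strand i)))"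
      using w by simp
  qed
qed

lemma reidemeister_sym: "reidemeister D D' \<Longrightarrow> reidemeister D' D"
  unfolding reidemeister_def by blast

text \<open>Unwelded equivalence also allows the converse of each step. The converses are realised
  move by move, which avoids running movies backwards.\<close>

lemma unwelded_move_cobordant:
  assumes "(D, D') \<in> unwelded_moves n"
  shows "(D, D') \<in> cobordant n \<and> (D', D) \<in> cobordant n"
proof -
  have SL: "D \<in> string_link_diagrams n" "D' \<in> string_link_diagrams n"
    and "(\<exists>g. isomorphism g D D') \<or> reidemeister D D' \<or> forbidden1 D D' \<or> forbidden2 D D'"
    using assms unfolding unwelded_moves_def by blast+
  then consider g where "isomorphism g D D'" | "reidemeister D D'"
    | p q where "adjacent D p q" "D' = exchange p q D"
    unfolding forbidden1_def forbidden2_def by blast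
  then show ?thesis
  proof cases
    case 1
    then show ?thesis
      using cobordant_isomorphism isomorphism_string_link_sym SL by blast
  next
    case 2
    then show ?thesis
      using cobordant_reidemeister reidemeister_sym SL by blast
  next
    case 3
    then show ?thesis
      using cobordant_exchange cobordant_exchange_sym SL by blast
  qed
qed

lemma unwelded_equivalent_cobordant:
  assumes "(D, D') \<in> unwelded_equivalent n"
  shows "(D, D') \<in> cobordant n"
proof -
  have D: "D \<in> string_link_diagrams n"
    and path: "(D, D') \<in> (unwelded_moves n \<union> (unwelded_moves n)\<inverse>)\<^sup>*"
    using assms unfolding unwelded_equivalent_def by blast+
  from path show ?thesis
  proof (induction rule: rtrancl_induct)
    case base
    then show ?case
      using cobordant_refl[OF D] .
  next
    case (step E E')
    then have "(E, E') \<in> cobordant n"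
      using unwelded_move_cobordant by blast
    then show ?case
      using step.IH cobordant_trans by blast
  qed
qed


section \<open>Exchanging adjacent endpoints by unwelded moves\<close>

lemma equiv_unwelded: "equiv (string_link_diagrams n) (unwelded_equivalent n)"
proof -
  let ?M = "unwelded_moves n \<union> (unwelded_moves n)\<inverse>"
  have "sym (?M\<^sup>*)"
    by (intro sym_rtrancl sym_Un_converse)
  then show ?thesis
    unfolding unwelded_equivalent_def
    by (intro equivI) (auto simp: refl_on_def sym_def trans_def intro: rtrancl_trans)
qed

lemma unwelded_refl: "D \<in> string_link_diagrams n \<Longrightarrow> (D, D) \<in> unwelded_equivalent n"
  using equiv_unwelded by (metis equiv_def refl_onD)

lemma unwelded_sym: "(D, D') \<in> unwelded_equivalent n \<Longrightarrow> (D', D) \<in> unwelded_equivalent n"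
  using equiv_unwelded by (metis equiv_def symD)

lemma unwelded_trans [trans]:
  "(D, D') \<in> unwelded_equivalent n \<Longrightarrow> (D', D'') \<in> unwelded_equivalent n \<Longrightarrow>
    (D, D'') \<in> unwelded_equivalent n"
  using equiv_unwelded by (metis equiv_def transD)

lemma unwelded_string_link:
  assumes "(D, D') \<in> unwelded_equivalent n"
  shows "D \<in> string_link_diagrams n" "D' \<in> string_link_diagrams n"
  using assms unfolding unwelded_equivalent_def by blast+

lemma unwelded_move:
  assumes "D \<in> string_link_diagrams n" "D' \<in> string_link_diagrams n"
    and "isomorphism g D D' \<or> reidemeister D D' \<or> forbidden1 D D' \<or> forbidden2 D D'"
  shows "(D, D') \<in> unwelded_equivalent n"
proof -
  have "(D, D') \<in> unwelded_moves n"
    using assms unfolding unwelded_moves_def by blast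
  then show ?thesis
    using assms(1,2) unfolding unwelded_equivalent_def by blast
qed

lemma arrows_cong: "word D' = word D \<Longrightarrow> arrows D' = arrows D"
  by (simp add: arrows_def endpoints_def)

lemma string_link_cong:
  assumes "D \<in> string_link_diagrams n" "word D' = word D" "\<And>a. a \<in> arrows D \<Longrightarrow> writhe D' a = writhe D a"
  shows "D' \<in> string_link_diagrams n"
  using assms unfolding string_link_diagrams_def gauss_diagram_def components_def arrows_def endpoints_def
  by simp

lemma unwelded_cong:
  assumes D: "D \<in> string_link_diagrams n" and w: "word D' = word D"
    and "\<And>a. a \<in> arrows D \<Longrightarrow> writhe D' a = writhe D a"
  shows "(D, D') \<in> unwelded_equivalent n"
proof -
  have D': "D' \<in> string_link_diagrams n"
    using assms by (rule string_link_cong)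
  have "isomorphism id D D'"
    by (rule isomorphism_string_linkI[OF D D', of id]) (simp_all add: assms endpoint.map_id0)
  then show ?thesis
    using unwelded_move[OF D D'] by blast
qed

section \<open>Commuting exchanges and deletions; insertion of endpoints\<close>

lemma endpoints_exchange:
  assumes "p \<in> endpoints D" "q \<in> endpoints D"
  shows "endpoints (exchange p q D) = endpoints D"
proof -
  have "endpoints (exchange p q D) = Transposition.transpose p q ` endpoints D"
    by (auto simp: endpoints_eq points_exchange)
  then show ?thesis
    using assms by simp
qed

lemma exchange_comm:
  assumes "p \<noteq> r" "p \<noteq> s" "q \<noteq> r" "q \<noteq> s"
  shows "exchange p q (exchange r s D) = exchange r s (exchange p q D)"
proof -
  have "Transposition.transpose p q \<circ> Transposition.transpose r s =
      Transposition.transpose r s \<circ> Transposition.transpose p q"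
    using assms by (auto simp: fun_eq_iff Transposition.transpose_def)
  then show ?thesis
    by (simp add: exchange_def option.map_comp fun_eq_iff comp_def)
qed

lemma delete_arrows_exchange:
  assumes "p \<notin> Tail ` A \<union> Head ` A" "q \<notin> Tail ` A \<union> Head ` A"
  shows "delete_arrows A (exchange p q D) = exchange p q (delete_arrows A D)"
proof -
  have "Transposition.transpose p q r \<notin> Tail ` A \<union> Head ` A \<longleftrightarrow> r \<notin> Tail ` A \<union> Head ` A" for r
    using assms by (auto simp: Transposition.transpose_def)
  then show ?thesis
    by (simp add: exchange_def delete_arrows_def option.map_comp fun_eq_iff comp_def filter_map)
qed

text \<open>Used for the tail and the head of one arrow: both orders reduce to the same diagram when
  the arrow is deleted.\<close>

lemma delete_arrows_exchange_inside:
  assumes "p \<in> Tail ` A \<union> Head ` A" "q \<in> Tail ` A \<union> Head ` A"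
  shows "delete_arrows A (exchange p q D) = delete_arrows A D"
proof -
  have "filter (\<lambda>r. r \<notin> Tail ` A \<union> Head ` A) (map (Transposition.transpose p q) w) =
      filter (\<lambda>r. r \<notin> Tail ` A \<union> Head ` A) w" for w
    using assms by (induction w) (auto simp: Transposition.transpose_def)
  then show ?thesis
    by (simp add: exchange_def delete_arrows_def option.map_comp comp_def)
qed

lemma endpoints_delete_arrows: "endpoints (delete_arrows A D) = endpoints D - (Tail ` A \<union> Head ` A)"
  by (auto simp: endpoints_eq points_delete_arrows)

lemma string_link_delete_arrows:
  assumes D: "D \<in> string_link_diagrams n"
  shows "delete_arrows A D \<in> string_link_diagrams n"
proof -
  note G = string_link_gauss[OF D]
  have "gauss_diagram n (delete_arrows A D)"
  proof (rule gauss_diagramI)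
    show "distinct w" if "word (delete_arrows A D) c = Some w" for c w
      using that gauss_diagramD(3)[OF G] by auto
    show "c = c'" if "p \<in> points (delete_arrows A D) c" "p \<in> points (delete_arrows A D) c'" for p c c'
      using that gauss_diagramD(4)[OF G] unfolding points_delete_arrows by blast
    show "Tail a \<in> endpoints (delete_arrows A D) \<longleftrightarrow> Head a \<in> endpoints (delete_arrows A D)" for a
      using gauss_diagramD(5)[OF G, of a] by (auto simp: endpoints_delete_arrows)
    show "writhe (delete_arrows A D) a = 1 \<or> writhe (delete_arrows A D) a = - 1"
      if "a \<in> arrows (delete_arrows A D)" for a
      using that gauss_diagramD(6)[OF G, of a] by (simp add: arrows_def endpoints_delete_arrows)
  qed (use gauss_diagramD[OF G] in simp_all)
  then show ?thesis
    using D by (simp add: string_link_diagrams_def)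
qed

text \<open>RM2 is formulated as a deletion, so creating arrows means exhibiting the larger diagram.
  It is obtained by replacing each old endpoint with a short list that contains it and its new
  neighbours.\<close>

definition expand :: "(nat endpoint \<Rightarrow> nat endpoint list) \<Rightarrow> diagram \<Rightarrow> diagram" where
  "expand f D = D\<lparr>word := \<lambda>c. map_option (\<lambda>w. concat (map f w)) (word D c)\<rparr>"

lemma points_expand: "points (expand f D) c = (\<Union>r \<in> points D c. set (f r))"
  by (simp add: expand_def points_def split: option.splits)

lemma components_expand [simp]: "components (expand f D) = components D"
  by (auto simp: expand_def components_def)

lemma follows_expand_inside:
  assumes "r \<in> endpoints D" "f r = x @ [p, q] @ y"
  shows "follows (expand f D) p q"
proof -
  obtain c w where w: "word D c = Some w" "r \<in> set w"
    using assms(1) unfolding in_endpoints_iff by blast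
  obtain u v where "w = u @ r # v"
    using split_list[OF w(2)] by blast
  then have "word (expand f D) c = Some ((concat (map f u) @ x) @ [p, q] @ (y @ concat (map f v)))"
    using w assms(2) by (simp add: expand_def)
  then show ?thesis
    unfolding follows_def by blast
qed

lemma follows_expand_outside:
  assumes "D \<in> string_link_diagrams n" "follows D p q" "f p = [p]" "f q = [q]"
  shows "follows (expand f D) p q"
proof -
  obtain i u v where "word D (Strand i) = Some (u @ [p, q] @ v)"
    using string_link_follows[OF assms(1,2)] by metis
  then have "word (expand f D) (Strand i) = Some (concat (map f u) @ [p, q] @ concat (map f v))"
    using assms(3,4) by (simp add: expand_def)
  then show ?thesis
    unfolding follows_def by blast
qed

text \<open>The map \<open>g\<close> sends every element of a block back to the entry it replaces,
  so blocks of different entries cannot overlap.\<close>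

lemma distinct_concat_map:
  assumes "distinct w" "\<And>r. r \<in> set w \<Longrightarrow> distinct (f r)" "\<And>r s. r \<in> set w \<Longrightarrow> s \<in> set (f r) \<Longrightarrow> g s = r"
  shows "distinct (concat (map f w))"
  using assms
proof (induction w)
  case (Cons a w)
  have "set (f a) \<inter> set (concat (map f w)) = {}"
  proof (rule ccontr)
    assume "set (f a) \<inter> set (concat (map f w)) \<noteq> {}"
    then obtain r s where "r \<in> set w" "s \<in> set (f r)" "s \<in> set (f a)"
      by auto
    then have "a = r"
      using Cons.prems(3)[of a s] Cons.prems(3)[of r s] by simp
    then show False
      using Cons.prems(1) \<open>r \<in> set w\<close> by simp
  qed
  then show ?case
    using Cons by simp
qed simp

text \<open>
  The third Reidemeister move exchanges the head of \<open>x\<close> with the tail of \<open>z\<close> once an arrow \<open>y\<close> from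
  the tail of \<open>x\<close> to the head of \<open>z\<close> is present. Such an arrow is created together with an opposite
  one \<open>y'\<close>; afterwards the forbidden moves undo the exchanges at the tail of \<open>x\<close> and at the head of
  \<open>z\<close>, so that \<open>y\<close> and \<open>y'\<close> cancel. The signs of \<open>x\<close> and \<open>z\<close> dictate on which sides \<open>y\<close> has to be
  inserted and its sign.
\<close>

lemma unwelded_exchange_head_tail:
  assumes D: "D \<in> string_link_diagrams n" and em: "em \<in> {1, - 1}"
    and xz: "in_order D em (Head x) (Tail z)" "x \<noteq> z"
  shows "(D, exchange (Head x) (Tail z) D) \<in> unwelded_equivalent n"
proof -
  note G = string_link_gauss[OF D]
  have adj_xz: "adjacent D (Head x) (Tail z)"
    using xz(1) unfolding in_order_def adjacent_def by (auto split: if_splits)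
  have ends: "Head x \<in> endpoints D" "Tail z \<in> endpoints D"
    using adjacent_endpoints[OF adj_xz] .
  then have ends': "Tail x \<in> endpoints D" "Head z \<in> endpoints D" and arr: "x \<in> arrows D" "z \<in> arrows D"
    using gauss_diagramD(5)[OF G] by (auto simp: arrows_def)
  have fin: "finite (arrows D)"
    using finite_arrows[OF G] .
  obtain y where y: "y \<notin> arrows D"
    using ex_new_if_finite[OF infinite_UNIV_nat fin] by blast
  obtain y' where y': "y' \<notin> insert y (arrows D)"
    using ex_new_if_finite[OF infinite_UNIV_nat, of "insert y (arrows D)"] fin by blast
  have new: "Tail y \<notin> endpoints D" "Tail y' \<notin> endpoints D" "Head y \<notin> endpoints D" "Head y' \<notin> endpoints D"
    using y y' gauss_diagramD(5)[OF G] by (auto simp: arrows_def)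
  have ne: "y \<noteq> y'" "x \<noteq> y" "z \<noteq> y" "x \<noteq> y'" "z \<noteq> y'"
    using y y' arr by auto
  \<comment> \<open>With \<open>d = 1\<close>, RM3 requires \<open>writhe D x = et * em\<close> and
    \<open>writhe D z = em * eb\<close>. As \<open>em * em = 1\<close>, these are solved by the
    following values, and the sign \<open>et * eb\<close> required of \<open>y\<close> becomes
    \<open>writhe D x * writhe D z\<close>.\<close>
  define et where "et = writhe D x * em"
  define eb where "eb = writhe D z * em"
  have wx: "writhe D x \<in> {1, - 1}" and wz: "writhe D z \<in> {1, - 1}"
    using gauss_diagramD(6)[OF G] arr by auto
  have e: "et \<in> {1, - 1}" "eb \<in> {1, - 1}"
    using wx wz em by (auto simp: et_def eb_def)
  have signs: "writhe D x = 1 * et * em" "writhe D x * writhe D z = 1 * et * eb" "writhe D z = 1 * em * eb"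
    using em by (auto simp: et_def eb_def)
  \<comment> \<open>The parameters \<open>et\<close> and \<open>eb\<close> prescribe on which side
    of \<open>Tail x\<close> and of \<open>Head z\<close> the ends of \<open>y\<close> must lie. The
    ends of \<open>y'\<close> go beyond those of \<open>y\<close>, so that nothing separates
    \<open>y\<close> from the old endpoints and \<open>y\<close>, \<open>y'\<close> stay adjacent at
    both ends.\<close>
  define f where "f r =
    (if r = Tail x then (if et = 1 then [Tail x, Tail y, Tail y'] else [Tail y', Tail y, Tail x])
     else if r = Head z then (if eb = 1 then [Head y', Head y, Head z] else [Head z, Head y, Head y'])
     else [r])" for r
  define g where "g s =
    (if s \<in> {Tail y, Tail y'} then Tail x else if s \<in> {Head y, Head y'} then Head z else s)" for s
  have set_f: "set (f r) = insert r ((if r = Tail x then {Tail y, Tail y'} else {}) \<union>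
      (if r = Head z then {Head y, Head y'} else {}))" for r
    by (auto simp: f_def)
  have g: "g s = r" if "r \<in> endpoints D" "s \<in> set (f r)" for r s
    using that new unfolding set_f g_def by (auto split: if_splits)
  have distinct_f: "distinct (f r)" for r
    using ne by (auto simp: f_def)
  define B where "B = D\<lparr>writhe := (writhe D)(y := writhe D x * writhe D z, y' := - (writhe D x * writhe D z))\<rparr>"
  have word_B: "word B = word D"
    by (simp add: B_def)
  have writhe_B: "writhe B a = writhe D a" if "a \<in> arrows D" for a
    using that y y' by (auto simp: B_def)
  have B: "B \<in> string_link_diagrams n"
    using string_link_cong[OF D word_B writhe_B] .
  have D_B: "(D, B) \<in> unwelded_equivalent n"
    using unwelded_cong[OF D word_B writhe_B] .
  have ends_B: "endpoints B = endpoints D"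
    by (simp add: endpoints_def word_B)
  note GB = string_link_gauss[OF B]
  define C where "C = expand f B"
  have writhe_C: "writhe C x = writhe D x" "writhe C z = writhe D z"
      "writhe C y = writhe D x * writhe D z" "writhe C y' = - writhe C y"
    using ne by (simp_all add: C_def expand_def B_def)
  have retract: "g s \<in> points B c" if s: "s \<in> points C c" for s c
  proof -
    obtain r where r: "r \<in> points B c" "s \<in> set (f r)"
      using s unfolding C_def points_expand by blast
    have "r \<in> endpoints B"
      unfolding endpoints_eq using r(1) by (rule UN_I[OF UNIV_I])
    then have "g s = r"
      using r(2) by (intro g) (simp_all add: ends_B)
    then show ?thesis
      using r(1) by simp
  qed
  have ends_C: "endpoints C = endpoints D \<union> {Tail y, Tail y', Head y, Head y'}"
  proof -
    have "endpoints C = (\<Union>r \<in> endpoints B. set (f r))"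
      unfolding endpoints_eq C_def points_expand by blast
    also have "\<dots> = endpoints D \<union> {Tail y, Tail y', Head y, Head y'}"
      unfolding ends_B set_f using ends' by (auto split: if_splits)
    finally show ?thesis .
  qed
  have "gauss_diagram n C"
  proof (rule gauss_diagramI)
    show "distinct w" if w: "word C c = Some w" for c w
    proof -
      obtain v where v: "word B c = Some v" "w = concat (map f v)"
        using w by (auto simp: C_def expand_def)
      have "r \<in> endpoints D" if "r \<in> set v" for r
        unfolding ends_B[symmetric] in_endpoints_iff using v(1) that by blast
      then show ?thesis
        unfolding v(2) using distinct_f g gauss_diagramD(3)[OF GB v(1)]
        by (intro distinct_concat_map[where g = g]) auto
    qed
    show "c = c'" if "p \<in> points C c" "p \<in> points C c'" for p c c'
      using retract[OF that(1)] retract[OF that(2)] gauss_diagramD(4)[OF GB] by blast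
    show "Tail a \<in> endpoints C \<longleftrightarrow> Head a \<in> endpoints C" for a
      using gauss_diagramD(5)[OF G] by (auto simp: ends_C)
    show "writhe C a = 1 \<or> writhe C a = - 1" if "a \<in> arrows C" for a
    proof (cases "a \<in> {y, y'}")
      case True
      then show ?thesis
        using wx wz writhe_C by auto
    next
      case False
      then have "a \<in> arrows D"
        using that by (auto simp: arrows_def ends_C)
      then show ?thesis
        using False gauss_diagramD(6)[OF G] by (simp add: C_def expand_def B_def)
    qed
  qed (use gauss_diagramD[OF GB] in \<open>simp_all add: C_def\<close>)
  then have C: "C \<in> string_link_diagrams n"
    using B by (simp add: string_link_diagrams_def C_def)
  have delete_C: "delete_arrows {y, y'} C = B"
  proof (rule diagram.equality)
    show "word (delete_arrows {y, y'} C) = word B"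
    proof
      fix c
      have "filter (\<lambda>p. p \<notin> Tail ` {y, y'} \<union> Head ` {y, y'}) (concat (map f v)) = v"
        if v: "word B c = Some v" for v
      proof -
        have "filter (\<lambda>p. p \<notin> Tail ` {y, y'} \<union> Head ` {y, y'}) (f r) = [r]" if "r \<in> set v" for r
        proof -
          have "r \<in> endpoints D"
            unfolding ends_B[symmetric] in_endpoints_iff using v that by blast
          then have "r \<notin> Tail ` {y, y'} \<union> Head ` {y, y'}"
            using new by auto
          then show ?thesis
            using ne by (auto simp: f_def)
        qed
        then have "\<forall>r \<in> set v. filter (\<lambda>p. p \<notin> Tail ` {y, y'} \<union> Head ` {y, y'}) (f r) = [r]"
          by blast
        then show ?thesis
          by (induction v) auto
      qed
      then show "word (delete_arrows {y, y'} C) c = word B c"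
        by (cases "word B c") (auto simp: C_def expand_def)
    qed
  qed (simp_all add: C_def expand_def delete_arrows_def)
  have inside: "follows C p q" if "r \<in> endpoints D" "f r = u @ [p, q] @ v" for r u p q v
    unfolding C_def using that by (intro follows_expand_inside[of r B f]) (simp_all add: ends_B)
  have tails: "in_order C et (Tail x) (Tail y) \<and> adjacent C (Tail y) (Tail y')"
  proof (cases "et = 1")
    case True
    then have "f (Tail x) = [] @ [Tail x, Tail y] @ [Tail y']" "f (Tail x) = [Tail x] @ [Tail y, Tail y'] @ []"
      by (simp_all add: f_def)
    from this[THEN inside[OF ends'(1)]] show ?thesis
      using True by (simp add: in_order_def adjacent_def)
  next
    case False
    then have "f (Tail x) = [Tail y'] @ [Tail y, Tail x] @ []" "f (Tail x) = [] @ [Tail y', Tail y] @ [Tail x]"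
      by (simp_all add: f_def)
    from this[THEN inside[OF ends'(1)]] show ?thesis
      using False by (simp add: in_order_def adjacent_def)
  qed
  have heads: "in_order C eb (Head y) (Head z) \<and> adjacent C (Head y) (Head y')"
  proof (cases "eb = 1")
    case True
    then have "f (Head z) = [Head y'] @ [Head y, Head z] @ []" "f (Head z) = [] @ [Head y', Head y] @ [Head z]"
      by (simp_all add: f_def)
    from this[THEN inside[OF ends'(2)]] show ?thesis
      using True by (simp add: in_order_def adjacent_def)
  next
    case False
    then have "f (Head z) = [] @ [Head z, Head y] @ [Head y']" "f (Head z) = [Head z] @ [Head y, Head y'] @ []"
      by (simp_all add: f_def)
    from this[THEN inside[OF ends'(2)]] show ?thesis
      using False by (simp add: in_order_def adjacent_def)
  qed
  note tails = conjunct1[OF tails] conjunct2[OF tails] and heads = conjunct1[OF heads] conjunct2[OF heads]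
  have follows_B: "follows B p q \<longleftrightarrow> follows D p q" for p q
    by (simp add: follows_def word_B)
  have fxz: "f (Head x) = [Head x]" "f (Tail z) = [Tail z]"
    using xz(2) by (auto simp: f_def)
  have middle: "in_order C em (Head x) (Tail z)"
    using xz(1) follows_expand_outside[OF B, of "Head x" "Tail z" f]
      follows_expand_outside[OF B, of "Tail z" "Head x" f] fxz
    unfolding in_order_def C_def follows_B by (auto split: if_splits)
  have in_C: "Tail x \<in> endpoints C" "Tail y \<in> endpoints C" "Head x \<in> endpoints C" "Tail z \<in> endpoints C"
      "Head y \<in> endpoints C" "Head z \<in> endpoints C"
    using ends ends' by (auto simp: ends_C)
  have adj: "adjacent C (Tail x) (Tail y)" "adjacent C (Head y) (Head z)"
    using tails heads unfolding in_order_def adjacent_def by (auto split: if_splits)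
  \<comment> \<open>The result of RM3 on \<open>C\<close> is \<open>C3\<close>. A tail exchange
    leads to \<open>C2\<close>, and a head exchange relates \<open>C2\<close> to \<open>C'\<close>,
    which differs from \<open>C\<close> only in the wanted exchange.\<close>
  define C1 where "C1 = exchange (Head y) (Head z) C"
  define C2 where "C2 = exchange (Head x) (Tail z) C1"
  define C3 where "C3 = exchange (Tail x) (Tail y) C2"
  define C' where "C' = exchange (Head x) (Tail z) C"
  have C1: "C1 \<in> string_link_diagrams n" "endpoints C1 = endpoints C"
    unfolding C1_def using in_C by (simp_all add: string_link_exchange[OF C] endpoints_exchange)
  have C2: "C2 \<in> string_link_diagrams n" "endpoints C2 = endpoints C"
    unfolding C2_def using in_C C1 by (simp_all add: string_link_exchange[OF C1(1)] endpoints_exchange)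
  have C3: "C3 \<in> string_link_diagrams n"
    unfolding C3_def using in_C C2 by (simp add: string_link_exchange[OF C2(1)])
  have C': "C' \<in> string_link_diagrams n"
    unfolding C'_def using in_C by (simp add: string_link_exchange[OF C])
  have "RM2 C B"
    unfolding RM2_def using ne tails(2) heads(2) writhe_C(4) delete_C
    by (intro exI[of _ y] exI[of _ y']) simp
  then have B_C: "(B, C) \<in> unwelded_equivalent n"
    by (intro unwelded_move[OF B C]) (simp add: reidemeister_def)
  have W: "writhe C x = 1 * et * em" "writhe C y = 1 * et * eb" "writhe C z = 1 * em * eb"
    using signs writhe_C by metis+
  have C3_eq: "C3 = exchange (Tail x) (Tail y) (exchange (Head x) (Tail z) (exchange (Head y) (Head z) C))"
    unfolding C1_def C2_def C3_def by (rule refl)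
  have "RM3 C C3"
    unfolding RM3_def
    by (rule exI[of _ x], rule exI[of _ y], rule exI[of _ z], rule exI[of _ 1],
        rule exI[of _ et], rule exI[of _ em], rule exI[of _ eb])
      (use ne(2) ne(3)[symmetric] xz(2) e em tails(1) heads(1) middle W C3_eq in blast)
  then have C_C3: "(C, C3) \<in> unwelded_equivalent n"
    by (intro unwelded_move[OF C C3]) (simp add: reidemeister_def)
  have "adjacent C3 (Tail y) (Tail x)"
    using adjacent_exchange[OF adjacent_exchange[OF adjacent_exchange[OF adj(1),
        of "Head y" "Head z"], of "Head x" "Tail z"], of "Tail x" "Tail y"] ne xz(2)
    by (simp add: C1_def C2_def C3_def)
  moreover have "C2 = exchange (Tail y) (Tail x) C3"
    by (simp add: C3_def exchange_commute[of "Tail y"])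
  ultimately have C3_C2: "(C3, C2) \<in> unwelded_equivalent n"
    by (intro unwelded_move[OF C3 C2(1)]) (auto simp: forbidden1_def)
  have C2_eq: "C2 = exchange (Head y) (Head z) C'"
    unfolding C2_def C1_def C'_def using ne xz(2) by (intro exchange_comm) auto
  have "adjacent C' (Head y) (Head z)"
    using adjacent_exchange[OF adj(2), of "Head x" "Tail z"] ne xz(2) by (simp add: C'_def)
  then have C'_C2: "(C', C2) \<in> unwelded_equivalent n"
    using C2_eq by (intro unwelded_move[OF C' C2(1)]) (auto simp: forbidden2_def)
  let ?B' = "exchange (Head x) (Tail z) B"
  have B': "?B' \<in> string_link_diagrams n"
    using ends by (simp add: string_link_exchange[OF B] ends_B)
  have "?B' = delete_arrows {y, y'} C'"
    unfolding C'_def delete_C[symmetric] using ne by (intro delete_arrows_exchange[symmetric]) auto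
  moreover have "adjacent C' (Tail y) (Tail y')" "adjacent C' (Head y) (Head y')"
    using adjacent_exchange[OF tails(2), of "Head x" "Tail z"]
      adjacent_exchange[OF heads(2), of "Head x" "Tail z"] ne by (simp_all add: C'_def)
  ultimately have "RM2 C' ?B'"
    unfolding RM2_def using ne(1) writhe_C(4)
    by (intro exI[of _ y] exI[of _ y']) (simp add: C'_def)
  then have C'_B': "(C', ?B') \<in> unwelded_equivalent n"
    by (intro unwelded_move[OF C' B']) (simp add: reidemeister_def)
  have D': "exchange (Head x) (Tail z) D \<in> string_link_diagrams n"
    using ends by (intro string_link_exchange[OF D])
  have "(exchange (Head x) (Tail z) D, ?B') \<in> unwelded_equivalent n"
  proof (rule unwelded_cong[OF D'])
    show "word ?B' = word (exchange (Head x) (Tail z) D)"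
      by (simp add: fun_eq_iff word_B)
    show "writhe ?B' a = writhe (exchange (Head x) (Tail z) D) a"
      if "a \<in> arrows (exchange (Head x) (Tail z) D)" for a
      using that writhe_B ends by (simp add: arrows_def endpoints_exchange)
  qed
  then show ?thesis
    using D_B B_C C_C3 C3_C2 C'_C2 C'_B' unwelded_trans unwelded_sym by meson
qed

text \<open>Two tails or two heads are exchanged by a forbidden move. The two ends of one arrow are
  handled by RM1, which deletes the arrow in either order; a head and a tail of different arrows are
  covered by the preceding lemma.\<close>

lemma unwelded_exchange:
  assumes D: "D \<in> string_link_diagrams n" and adj: "adjacent D p q"
  shows "(D, exchange p q D) \<in> unwelded_equivalent n"
proof -
  have E: "exchange p q D \<in> string_link_diagrams n"
    using adjacent_endpoints[OF adj] by (rule string_link_exchange[OF D])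
  have self: "(D, exchange p q D) \<in> unwelded_equivalent n"
    if a: "{p, q} = {Tail a, Head a}" for a
  proof -
    have sub: "p \<in> Tail ` {a} \<union> Head ` {a}" "q \<in> Tail ` {a} \<union> Head ` {a}"
      using a by (auto simp: doubleton_eq_iff)
    have adj': "adjacent D (Tail a) (Head a)"
      using adj a unfolding adjacent_def by (auto simp: doubleton_eq_iff)
    have "adjacent (exchange p q D) q p"
      using adjacent_exchange[OF adj, of p q] by simp
    then have "adjacent (exchange p q D) (Tail a) (Head a)"
      using a unfolding adjacent_def by (auto simp: doubleton_eq_iff)
    then have "RM1 (exchange p q D) (delete_arrows {a} D)"
      unfolding RM1_def using delete_arrows_exchange_inside[OF sub, of D] by metis
    moreover have "RM1 D (delete_arrows {a} D)"
      unfolding RM1_def using adj' by blast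
    ultimately have "(D, delete_arrows {a} D) \<in> unwelded_equivalent n"
        "(exchange p q D, delete_arrows {a} D) \<in> unwelded_equivalent n"
      using unwelded_move[OF D string_link_delete_arrows[OF D]]
        unwelded_move[OF E string_link_delete_arrows[OF D]] by (simp_all add: reidemeister_def)
    then show ?thesis
      using unwelded_trans unwelded_sym by blast
  qed
  have mixed: "(D, exchange (Head x) (Tail z) D) \<in> unwelded_equivalent n"
    if a: "adjacent D (Head x) (Tail z)" "x \<noteq> z" for x z
    using a unwelded_exchange_head_tail[OF D, of 1 x z] unwelded_exchange_head_tail[OF D, of "- 1" x z]
    unfolding adjacent_def in_order_def by auto
  have adj': "adjacent D q p"
    using adj unfolding adjacent_def by blast
  show ?thesis
  proof (cases p)
    case p: (Tail a)
    show ?thesis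
    proof (cases q)
      case (Tail b)
      then have "forbidden1 D (exchange p q D)"
        unfolding forbidden1_def using adj p by blast
      then show ?thesis
        using unwelded_move[OF D E] by blast
    next
      case (Head b)
      then show ?thesis
        using self[of a] mixed[of b a] p adj' by (cases "a = b") (auto simp: exchange_commute[of "Tail a"])
    qed
  next
    case p: (Head a)
    show ?thesis
    proof (cases q)
      case (Tail b)
      then show ?thesis
        using self[of a] mixed[of a b] p adj by (cases "a = b") auto
    next
      case (Head b)
      then have "forbidden2 D (exchange p q D)"
        unfolding forbidden2_def using adj p by blast
      then show ?thesis
        using unwelded_move[OF D E] by blast
    qed
  qed
qed


section \<open>Classification of string links up to unwelded equivalence\<close>

definition set_word :: "diagram \<Rightarrow> component \<Rightarrow> nat endpoint list \<Rightarrow> diagram" where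
  "set_word D c w = D\<lparr>word := (word D)(c \<mapsto> w)\<rparr>"

lemma set_word_simps [simp]:
  "word (set_word D c w) = (word D)(c \<mapsto> w)" "writhe (set_word D c w) = writhe D"
  "set_word (set_word D c w) c w' = set_word D c w'"
  by (simp_all add: set_word_def)

lemma set_word_same: "word D c = Some w \<Longrightarrow> set_word D c w = D"
  by (intro diagram.equality) (auto simp: set_word_def)

lemma unwelded_swap:
  assumes D: "D \<in> string_link_diagrams n" and w: "word D c = Some (u @ [p, q] @ v)"
  shows "(D, set_word D c (u @ [q, p] @ v)) \<in> unwelded_equivalent n"
proof -
  have "adjacent D p q"
    unfolding adjacent_def follows_def using w by blast
  then show ?thesis
    using unwelded_exchange[OF D] exchange_neighbours[OF string_link_gauss[OF D] w]
    by (metis set_word_def)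
qed

text \<open>\<open>a\<close> passes the entries of \<open>x\<close> from right to left, hence the
  induction on \<open>x\<close> from its end.\<close>

lemma unwelded_move_to_front:
  assumes "D \<in> string_link_diagrams n" "word D c = Some (u @ x @ [a] @ y)"
  shows "(D, set_word D c (u @ [a] @ x @ y)) \<in> unwelded_equivalent n"
  using assms
proof (induction x arbitrary: D y rule: rev_induct)
  case Nil
  then show ?case
    using unwelded_refl by (simp add: set_word_same)
next
  case (snoc b x)
  have "(D, set_word D c ((u @ x) @ [a, b] @ y)) \<in> unwelded_equivalent n"
    using snoc.prems by (intro unwelded_swap) simp_all
  moreover from unwelded_string_link(2)[OF this]
  have "(set_word D c ((u @ x) @ [a, b] @ y),
      set_word (set_word D c ((u @ x) @ [a, b] @ y)) c (u @ [a] @ x @ ([b] @ y))) \<in> unwelded_equivalent n"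
    by (rule snoc.IH) simp
  ultimately show ?case
    using unwelded_trans by simp
qed

text \<open>Selection sort: \<open>u\<close> holds the part already in its target order, and the
  next entry of the target is pulled to the front of the remainder.\<close>

lemma unwelded_permute_suffix:
  assumes "D \<in> string_link_diagrams n" "word D c = Some (u @ w)" "mset w' = mset w"
  shows "(D, set_word D c (u @ w')) \<in> unwelded_equivalent n"
  using assms
proof (induction w' arbitrary: D u w)
  case Nil
  then show ?case
    using unwelded_refl by (simp add: set_word_same)
next
  case (Cons a w')
  have "a \<in> set w"
    using Cons.prems(3) by (metis list.set_intros(1) set_mset_mset)
  then obtain x y where w: "w = x @ a # y"
    using split_list by metis
  define D1 where "D1 = set_word D c (u @ [a] @ x @ y)"
  have D_D1: "(D, D1) \<in> unwelded_equivalent n"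
    unfolding D1_def using Cons.prems w by (intro unwelded_move_to_front) simp_all
  have "(D1, set_word D1 c ((u @ [a]) @ w')) \<in> unwelded_equivalent n"
    using Cons.prems(3) w
    by (intro Cons.IH[OF unwelded_string_link(2)[OF D_D1], of _ "x @ y"]) (simp_all add: D1_def)
  then show ?case
    using D_D1 unwelded_trans by (simp add: D1_def)
qed

lemma unwelded_permute_word:
  assumes "D \<in> string_link_diagrams n" "word D c = Some w" "distinct w'" "set w' = set w"
  shows "(D, set_word D c w') \<in> unwelded_equivalent n"
proof -
  have "distinct w"
    using assms string_link_gauss gauss_diagramD(3) by blast
  then have "mset w' = mset w"
    using assms by (simp add: set_eq_iff_mset_eq_distinct)
  then show ?thesis
    using unwelded_permute_suffix[of D n c "[]" w w'] assms by simp
qed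

lemma string_link_components:
  "D \<in> string_link_diagrams n \<Longrightarrow> components D = Strand ` {1..n}"
  using string_link_component[of D n] gauss_diagramD(2)[OF string_link_gauss]
  by (auto simp: image_iff) (metis atLeastAtMost_iff)

lemma string_link_word:
  assumes "D \<in> string_link_diagrams n" "i \<in> {1..n}"
  obtains w where "word D (Strand i) = Some w" "distinct w" "points D (Strand i) = set w"
proof -
  have "Strand i \<in> components D"
    using string_link_components[OF assms(1)] assms(2) by blast
  then show ?thesis
    using that gauss_diagramD(3)[OF string_link_gauss[OF assms(1)]] by (auto simp: components_def)
qed

lemma unwelded_same_points:
  assumes D: "D \<in> string_link_diagrams n" and D': "D' \<in> string_link_diagrams n"
    and points: "\<And>i. i \<in> {1..n} \<Longrightarrow> points D (Strand i) = points D' (Strand i)"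
    and writhe: "\<And>a. a \<in> arrows D \<Longrightarrow> writhe D' a = writhe D a"
  shows "(D, D') \<in> unwelded_equivalent n"
proof -
  \<comment> \<open>The strands are rearranged one at a time; in \<open>E k\<close> the first
    \<open>k\<close> of them already carry the words of \<open>D'\<close>.\<close>
  define E where "E k = D\<lparr>word := \<lambda>c. if c \<in> Strand ` {1..k} then word D' c else word D c\<rparr>" for k
  have "(D, E k) \<in> unwelded_equivalent n" if "k \<le> n" for k
    using that
  proof (induction k)
    case 0
    then show ?case
      using unwelded_refl[OF D] by (simp add: E_def)
  next
    case (Suc k)
    then have IH: "(D, E k) \<in> unwelded_equivalent n"
      by simp
    have k: "Suc k \<in> {1..n}"
      using Suc.prems by simp
    obtain w where w: "word D (Strand (Suc k)) = Some w" "points D (Strand (Suc k)) = set w"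
      using string_link_word[OF D k] by metis
    obtain w' where w': "word D' (Strand (Suc k)) = Some w'" "distinct w'"
        "points D' (Strand (Suc k)) = set w'"
      using string_link_word[OF D' k] by metis
    have "(E k, set_word (E k) (Strand (Suc k)) w') \<in> unwelded_equivalent n"
      using w w' points[OF k]
      by (intro unwelded_permute_word[OF unwelded_string_link(2)[OF IH], of _ w]) (auto simp: E_def)
    moreover have "Strand ` {1..Suc k} = insert (Strand (Suc k)) (Strand ` {1..k})"
      by (simp add: atLeastAtMostSuc_conv)
    then have "set_word (E k) (Strand (Suc k)) w' = E (Suc k)"
      using w' by (intro diagram.equality) (auto simp: E_def set_word_def fun_eq_iff simp del: image_Suc_atLeastAtMost)
    ultimately show ?case
      using IH unwelded_trans by metis
  qed
  then have DE: "(D, E n) \<in> unwelded_equivalent n"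
    by simp
  have "word (E n) c = word D' c" for c
  proof (cases "c \<in> Strand ` {1..n}")
    case False
    then have "word D c = None" "word D' c = None"
      using string_link_components[OF D] string_link_components[OF D'] by (auto simp: components_def)
    then show ?thesis
      by (simp add: E_def)
  qed (simp add: E_def)
  then have word: "word D' = word (E n)"
    by auto
  have "endpoints D' = endpoints D"
  proof -
    have "points D c = points D' c" for c
      using points string_link_components[OF D] string_link_components[OF D'] points_component
      by (metis (no_types, lifting) imageE subsetI subset_antisym)
    then show ?thesis
      by (simp add: endpoints_eq)
  qed
  then have "arrows (E n) = arrows D"
    using arrows_cong[OF word] by (simp add: arrows_def)
  then have "(E n, D') \<in> unwelded_equivalent n"
    using writhe by (intro unwelded_cong[OF unwelded_string_link(2)[OF DE] word]) (simp add: E_def)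
  then show ?thesis
    using DE unwelded_trans by blast
qed

section \<open>Cancellation of arrows\<close>

lemma adjacent_prefix: "word D c = Some (p # q # v) \<Longrightarrow> adjacent D p q"
  unfolding adjacent_def follows_def by (metis append_Cons append_Nil)

lemma unwelded_delete_self_arrow:
  assumes D: "D \<in> string_link_diagrams n" and a: "Tail a \<in> points D c" "Head a \<in> points D c"
  shows "(D, delete_arrows {a} D) \<in> unwelded_equivalent n"
proof -
  obtain w where w: "word D c = Some w"
    using a by (auto simp: in_points_iff)
  let ?P = "\<lambda>p. p \<notin> Tail ` {a} \<union> Head ` {a}"
  define E where "E = set_word D c ([Tail a, Head a] @ filter ?P w)"
  have DE: "(D, E) \<in> unwelded_equivalent n"
    unfolding E_def using a w gauss_diagramD(3)[OF string_link_gauss[OF D] w]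
    by (intro unwelded_permute_word[OF D w]) auto
  then have E: "E \<in> string_link_diagrams n"
    by (rule unwelded_string_link)
  have "adjacent E (Tail a) (Head a)"
    by (rule adjacent_prefix[of _ c]) (simp add: E_def)
  moreover have "delete_arrows {a} D = delete_arrows {a} E"
    using w by (intro diagram.equality) (auto simp: E_def delete_arrows_def set_word_def fun_eq_iff)
  ultimately have "RM1 E (delete_arrows {a} D)"
    unfolding RM1_def by blast
  then have "(E, delete_arrows {a} D) \<in> unwelded_equivalent n"
    by (intro unwelded_move[OF E string_link_delete_arrows[OF D]]) (simp add: reidemeister_def)
  then show ?thesis
    using DE unwelded_trans by blast
qed

text \<open>Since tails and heads lie on different components, each pair can be brought to the front
  of its own word without disturbing the other; then RM2 applies.\<close>

lemma unwelded_delete_opposite_arrows: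
  assumes D: "D \<in> string_link_diagrams n" and ab: "a \<noteq> b" "writhe D a = - writhe D b"
    and tails: "Tail a \<in> points D c" "Tail b \<in> points D c"
    and heads: "Head a \<in> points D d" "Head b \<in> points D d" and "c \<noteq> d"
  shows "(D, delete_arrows {a, b} D) \<in> unwelded_equivalent n"
proof -
  note G = string_link_gauss[OF D]
  obtain w where w: "word D c = Some w"
    using tails by (auto simp: in_points_iff)
  obtain v where v: "word D d = Some v"
    using heads by (auto simp: in_points_iff)
  have no: "Head a \<notin> set w" "Head b \<notin> set w" "Tail a \<notin> set v" "Tail b \<notin> set v"
    using gauss_diagramD(4)[OF G, of _ c d] tails heads w v \<open>c \<noteq> d\<close> by auto
  let ?P = "\<lambda>p. p \<notin> Tail ` {a, b} \<union> Head ` {a, b}"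
  define E where "E = set_word D c ([Tail a, Tail b] @ filter ?P w)"
  define F where "F = set_word E d ([Head a, Head b] @ filter ?P v)"
  have DE: "(D, E) \<in> unwelded_equivalent n"
    unfolding E_def using tails no ab(1) w gauss_diagramD(3)[OF G w]
    by (intro unwelded_permute_word[OF D w]) auto
  have EF: "(E, F) \<in> unwelded_equivalent n"
    unfolding F_def using heads no ab(1) v gauss_diagramD(3)[OF G v] \<open>c \<noteq> d\<close>
    by (intro unwelded_permute_word[OF unwelded_string_link(2)[OF DE], of _ v]) (auto simp: E_def)
  then have F: "F \<in> string_link_diagrams n"
    by (rule unwelded_string_link)
  have "adjacent F (Tail a) (Tail b)"
    using \<open>c \<noteq> d\<close> by (intro adjacent_prefix[of _ c]) (simp add: E_def F_def)
  moreover have "adjacent F (Head a) (Head b)"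
    by (intro adjacent_prefix[of _ d]) (simp add: F_def)
  moreover have "delete_arrows {a, b} D = delete_arrows {a, b} F"
    using w v \<open>c \<noteq> d\<close>
    by (intro diagram.equality) (auto simp: E_def F_def delete_arrows_def set_word_def fun_eq_iff)
  ultimately have "RM2 F (delete_arrows {a, b} D)"
    unfolding RM2_def using ab by (intro exI[of _ a] exI[of _ b]) (simp add: E_def F_def)
  then have "(F, delete_arrows {a, b} D) \<in> unwelded_equivalent n"
    by (intro unwelded_move[OF F string_link_delete_arrows[OF D]]) (simp add: reidemeister_def)
  then show ?thesis
    using DE EF unwelded_trans by blast
qed

definition arrows_between :: "diagram \<Rightarrow> nat \<Rightarrow> nat \<Rightarrow> nat set" where
  "arrows_between D i j = {a. Tail a \<in> points D (Strand i) \<and> Head a \<in> points D (Strand j)}"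

text \<open>The diagrams in which no rearrangement of endpoints along the strands makes an RM1 or
  RM2 cancellation possible.\<close>

definition reduced :: "diagram \<Rightarrow> bool" where
  "reduced D \<longleftrightarrow> (\<forall>i. arrows_between D i i = {}) \<and>
     (\<forall>i j. \<forall>a \<in> arrows_between D i j. \<forall>b \<in> arrows_between D i j. writhe D a = writhe D b)"

lemma lk_eq_arrows_between: "lk D i j = sum (writhe D) (arrows_between D i j)"
proof -
  have "on_strand D i = points D (Strand i)" for i
    by (auto simp: on_strand_def in_points_iff)
  then show ?thesis
    by (simp add: lk_def arrows_between_def)
qed

lemma arrows_between_arrows: "arrows_between D i j \<subseteq> arrows D"
  unfolding arrows_between_def arrows_def endpoints_eq by blast

lemma arrow_between:
  assumes D: "D \<in> string_link_diagrams n" and "a \<in> arrows D"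
  obtains i j where "i \<in> {1..n}" "j \<in> {1..n}" "a \<in> arrows_between D i j"
proof -
  have strand: "\<exists>i \<in> {1..n}. p \<in> points D (Strand i)" if p: "p \<in> endpoints D" for p
  proof -
    obtain c where c: "p \<in> points D c"
      using p unfolding endpoints_eq by blast
    then have "c \<in> Strand ` {1..n}"
      using points_component string_link_components[OF D] by blast
    then show ?thesis
      using c by blast
  qed
  have "Tail a \<in> endpoints D" "Head a \<in> endpoints D"
    using assms arrows_iff_Head[OF string_link_gauss[OF D]] by (auto simp: arrows_def)
  then show ?thesis
    using strand that unfolding arrows_between_def by blast
qed

lemma arrows_between_unique:
  assumes D: "D \<in> string_link_diagrams n" and "a \<in> arrows_between D i j" "a \<in> arrows_between D i' j'"
  shows "i = i'" "j = j'"
  using gauss_diagramD(4)[OF string_link_gauss[OF D]] assms(2,3) unfolding arrows_between_def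
  by blast+

lemma arrows_delete_arrows: "arrows (delete_arrows A D) = arrows D - A"
  by (auto simp: arrows_def endpoints_delete_arrows)

text \<open>Each failure of \<open>reduced\<close> exhibits a self-arrow or an opposite pair that
  can be deleted, so the number of arrows decreases.\<close>

lemma unwelded_reduced:
  assumes "D \<in> string_link_diagrams n"
  shows "\<exists>D'. (D, D') \<in> unwelded_equivalent n \<and> reduced D'"
  using assms
proof (induction "card (arrows D)" arbitrary: D rule: less_induct)
  case less
  note D = less.prems
  show ?case
  proof (cases "reduced D")
    case True
    then show ?thesis
      using unwelded_refl[OF D] by blast
  next
    case False
    obtain A where A: "A \<noteq> {}" "A \<subseteq> arrows D" "(D, delete_arrows A D) \<in> unwelded_equivalent n"
    proof (cases "\<exists>i a. a \<in> arrows_between D i i")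
      case True
      then obtain i a where a: "a \<in> arrows_between D i i"
        by blast
      then have "(D, delete_arrows {a} D) \<in> unwelded_equivalent n"
        unfolding arrows_between_def by (intro unwelded_delete_self_arrow[OF D]) auto
      then show ?thesis
        using a arrows_between_arrows by (intro that[of "{a}"]) auto
    next
      case self: False
      then obtain i j a b where ab: "a \<in> arrows_between D i j" "b \<in> arrows_between D i j"
        "writhe D a \<noteq> writhe D b"
        using False unfolding reduced_def by blast
      have "i \<noteq> j"
        using self ab by blast
      have "a \<in> arrows D" "b \<in> arrows D"
        using ab arrows_between_arrows by blast+
      then have "writhe D a = - writhe D b"
        using ab(3) gauss_diagramD(6)[OF string_link_gauss[OF D], of a]
          gauss_diagramD(6)[OF string_link_gauss[OF D], of b] by auto
      then have "(D, delete_arrows {a, b} D) \<in> unwelded_equivalent n"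
        using ab \<open>i \<noteq> j\<close> unfolding arrows_between_def
        by (intro unwelded_delete_opposite_arrows[OF D, of a b "Strand i" "Strand j"]) auto
      then show ?thesis
        using \<open>a \<in> arrows D\<close> \<open>b \<in> arrows D\<close> by (intro that[of "{a, b}"]) auto
    qed
    have "arrows D - A \<subset> arrows D"
      using A(1,2) by blast
    then have "card (arrows (delete_arrows A D)) < card (arrows D)"
      unfolding arrows_delete_arrows
      by (rule psubset_card_mono[OF finite_arrows[OF string_link_gauss[OF D]]])
    then obtain D' where "(delete_arrows A D, D') \<in> unwelded_equivalent n" "reduced D'"
      using less.hyps unwelded_string_link(2)[OF A(3)] by blast
    then show ?thesis
      using A(3) unwelded_trans by blast
  qed
qed

text \<open>All arrows from \<open>i\<close> to \<open>j\<close> have one sign, so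
  \<open>lk D i j\<close> is plus or minus their number. For the sign that does not occur,
  \<open>nat\<close> truncates to 0.\<close>

lemma card_signed_arrows:
  assumes D: "D \<in> string_link_diagrams n" and "reduced D" and e: "e \<in> {1, - 1}"
  shows "card {a \<in> arrows_between D i j. writhe D a = e} = nat (e * lk D i j)"
proof -
  let ?S = "arrows_between D i j"
  have pm: "writhe D a = 1 \<or> writhe D a = - 1" if "a \<in> ?S" for a
    using that gauss_diagramD(6)[OF string_link_gauss[OF D]] arrows_between_arrows by blast
  consider "\<forall>a \<in> ?S. writhe D a = e" | "\<forall>a \<in> ?S. writhe D a = - e"
    using \<open>reduced D\<close> pm e unfolding reduced_def by (metis empty_iff insert_iff minus_minus)
  then show ?thesis
  proof cases
    case 1
    then have "{a \<in> ?S. writhe D a = e} = ?S"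
      by blast
    moreover have "lk D i j = e * int (card ?S)"
      unfolding lk_eq_arrows_between using 1 by simp
    ultimately show ?thesis
      using e by auto
  next
    case 2
    then have "{a \<in> ?S. writhe D a = e} = {}"
      using e by auto
    moreover have "lk D i j = - e * int (card ?S)"
      unfolding lk_eq_arrows_between using 2 by simp
    ultimately show ?thesis
      using e by (auto simp del: Collect_empty_eq)
  qed
qed

section \<open>Comparison of reduced diagrams\<close>

lemma bij_betw_of_card_fibres:
  assumes "finite A" "finite B" "\<And>y. card {a \<in> A. f a = y} = card {b \<in> B. g b = y}"
  obtains h where "bij_betw h A B" "\<forall>a \<in> A. g (h a) = f a"
proof -
  have "\<exists>h. bij_betw h {a \<in> A. f a = y} {b \<in> B. g b = y}" for y
    using assms by (intro finite_same_card_bij) auto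
  then obtain h where h: "\<And>y. bij_betw (h y) {a \<in> A. f a = y} {b \<in> B. g b = y}"
    by metis
  have img: "h (f a) a \<in> B \<and> g (h (f a) a) = f a" if "a \<in> A" for a
    using that bij_betwE[OF h[of "f a"]] by auto
  have "bij_betw (\<lambda>a. h (f a) a) A B"
  proof (rule bij_betw_imageI)
    show "inj_on (\<lambda>a. h (f a) a) A"
    proof (rule inj_onI)
      fix a b assume ab: "a \<in> A" "b \<in> A" "h (f a) a = h (f b) b"
      then have "f a = f b"
        using img by metis
      then show "a = b"
        using ab bij_betw_imp_inj_on[OF h[of "f a"]] unfolding inj_on_def by auto
    qed
    show "(\<lambda>a. h (f a) a) ` A = B"
    proof (intro set_eqI iffI)
      fix b assume "b \<in> B"
      then have "b \<in> h (g b) ` {a \<in> A. f a = g b}"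
        using bij_betw_imp_surj_on[OF h[of "g b"]] by auto
      then obtain a where "a \<in> A" "f a = g b" "b = h (g b) a"
        by auto
      then have "a \<in> A" "b = h (f a) a"
        by simp_all
      then show "b \<in> (\<lambda>a. h (f a) a) ` A"
        by (rule rev_image_eqI)
    qed (use img in auto)
  qed
  then show ?thesis
    using img that by blast
qed

text \<open>Linking numbers determine how many arrows there are for each source strand, target
  strand and sign. A bijection of arrows matching these data renames \<open>D\<close> so that it
  differs from \<open>D'\<close> only in the order of endpoints along the strands.\<close>

lemma unwelded_reduced_eq:
  assumes D: "D \<in> string_link_diagrams n" and D': "D' \<in> string_link_diagrams n"
    and red: "reduced D" "reduced D'"
    and lk: "\<And>i j. i \<in> {1..n} \<Longrightarrow> j \<in> {1..n} \<Longrightarrow> i \<noteq> j \<Longrightarrow> lk D i j = lk D' i j"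
  shows "(D, D') \<in> unwelded_equivalent n"
proof -
  note G = string_link_gauss[OF D] and G' = string_link_gauss[OF D']
  \<comment> \<open>The choice is unique for an arrow: its tail and its head each lie on exactly one
    strand.\<close>
  define kind where "kind E a = (SOME (i, j, e). a \<in> arrows_between E i j \<and> writhe E a = e)" for E a
  have kind: "kind E a = (i, j, e) \<longleftrightarrow> a \<in> arrows_between E i j \<and> writhe E a = e"
    if E: "E \<in> string_link_diagrams n" and a: "a \<in> arrows E" for E a i j e
  proof -
    obtain i' j' where ij: "a \<in> arrows_between E i' j'"
      using arrow_between[OF E a] by metis
    have uniq: "(case x of (i, j, e) \<Rightarrow> a \<in> arrows_between E i j \<and> writhe E a = e) \<longleftrightarrow>
        x = (i', j', writhe E a)" for x
      using ij arrows_between_unique[OF E] by (cases x) auto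
    then have "kind E a = (i', j', writhe E a)"
      unfolding kind_def using ij by (intro some_equality) simp_all
    then show ?thesis
      using uniq[of "(i, j, e)"] by auto
  qed
  have "card {a \<in> arrows D. kind D a = y} = card {a \<in> arrows D'. kind D' a = y}" for y
  proof -
    obtain i j e where y: "y = (i, j, e)"
      by (cases y)
    have fibre: "{a \<in> arrows E. kind E a = y} = {a \<in> arrows_between E i j. writhe E a = e}"
      if E: "E \<in> string_link_diagrams n" for E
      using kind[OF E] arrows_between_arrows unfolding y by blast
    \<comment> \<open>For the remaining triples both fibres are empty: a strand is out of range, the
      sign is impossible, or the arrow would be a self-arrow, which \<open>reduced\<close>
      excludes.\<close>
    have none: "{a \<in> arrows_between E i j. writhe E a = e} = {}"
      if E: "E \<in> string_link_diagrams n" "reduced E"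
        and no: "\<not> (i \<in> {1..n} \<and> j \<in> {1..n} \<and> i \<noteq> j \<and> e \<in> {1, - 1})" for E
    proof (rule ccontr)
      assume "{a \<in> arrows_between E i j. writhe E a = e} \<noteq> {}"
      then obtain a where a: "a \<in> arrows_between E i j" "writhe E a = e"
        by blast
      then have arr: "a \<in> arrows E"
        using arrows_between_arrows by blast
      obtain i' j' where "i' \<in> {1..n}" "j' \<in> {1..n}" "a \<in> arrows_between E i' j'"
        using arrow_between[OF E(1) arr] .
      then have "i \<in> {1..n}" "j \<in> {1..n}"
        using arrows_between_unique[OF E(1) a(1)] by simp_all
      moreover have "e \<in> {1, - 1}"
        using gauss_diagramD(6)[OF string_link_gauss[OF E(1)] arr] a(2) by simp
      moreover have "i \<noteq> j"
        using E(2) a(1) unfolding reduced_def by blast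
      ultimately show False
        using no by blast
    qed
    show ?thesis
      unfolding fibre[OF D] fibre[OF D']
    proof (cases "i \<in> {1..n} \<and> j \<in> {1..n} \<and> i \<noteq> j \<and> e \<in> {1, - 1}")
      case True
      then show "card {a \<in> arrows_between D i j. writhe D a = e} =
          card {a \<in> arrows_between D' i j. writhe D' a = e}"
        using lk[of i j] card_signed_arrows[OF D red(1), of e i j]
          card_signed_arrows[OF D' red(2), of e i j] by simp
    next
      case False
      show "card {a \<in> arrows_between D i j. writhe D a = e} =
          card {a \<in> arrows_between D' i j. writhe D' a = e}"
        unfolding none[OF D red(1) False] none[OF D' red(2) False] by (rule refl)
    qed
  qed
  then obtain h where h: "bij_betw h (arrows D) (arrows D')"
    and kind_h: "\<forall>a \<in> arrows D. kind D' (h a) = kind D a"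
    by (rule bij_betw_of_card_fibres[OF finite_arrows[OF G] finite_arrows[OF G']])
  have between_h: "h a \<in> arrows_between D' i j \<and> writhe D' (h a) = e \<longleftrightarrow>
      a \<in> arrows_between D i j \<and> writhe D a = e" if "a \<in> arrows D" for a i j e
    using that kind[OF D that, of i j e] kind[OF D' bij_betw_apply[OF h that], of i j e] kind_h that
    by simp
  \<comment> \<open>\<open>D\<close> with its arrows renamed by \<open>h\<close>. The signs are
    copied from \<open>D'\<close>, which agrees with the renamed signs of \<open>D\<close> because
    \<open>h\<close> preserves kinds.\<close>
  define E where "E = D\<lparr>word := \<lambda>c. map_option (map (map_endpoint h)) (word D c), writhe := writhe D'\<rparr>"
  have points_E: "points E c = map_endpoint h ` points D c" for c
    by (simp add: E_def points_def split: option.splits)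
  have endpoint_h: "map_endpoint h p \<in> points D' (Strand i) \<longleftrightarrow> p \<in> points D (Strand i)"
    if p: "p \<in> endpoints D" for p i
  proof -
    obtain a where a: "p = Tail a \<or> p = Head a"
      by (cases p) auto
    then have arr: "a \<in> arrows D"
      using p arrows_iff_Head[OF G] by (auto simp: arrows_def)
    obtain s t where st: "a \<in> arrows_between D s t"
      using arrow_between[OF D arr] by metis
    then have st': "h a \<in> arrows_between D' s t"
      using between_h[OF arr, of s t "writhe D a"] by blast
    have "Tail a \<in> points D (Strand i) \<longleftrightarrow> i = s" "Head a \<in> points D (Strand i) \<longleftrightarrow> i = t"
        "Tail (h a) \<in> points D' (Strand i) \<longleftrightarrow> i = s" "Head (h a) \<in> points D' (Strand i) \<longleftrightarrow> i = t"
      using st st' gauss_diagramD(4)[OF G, of _ "Strand i"] gauss_diagramD(4)[OF G', of _ "Strand i"]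
      unfolding arrows_between_def by blast+
    then show ?thesis
      using a by auto
  qed
  have points_eq: "points E c = points D' c" for c
  proof (cases "c \<in> Strand ` {1..n}")
    case True
    then obtain i where c: "c = Strand i"
      by blast
    show ?thesis
      unfolding points_E c
    proof (intro set_eqI iffI)
      fix q assume "q \<in> map_endpoint h ` points D (Strand i)"
      then obtain p where p: "p \<in> points D (Strand i)" "q = map_endpoint h p"
        by blast
      then have "p \<in> endpoints D"
        unfolding endpoints_eq by blast
      then show "q \<in> points D' (Strand i)"
        using endpoint_h p by blast
    next
      fix q assume q: "q \<in> points D' (Strand i)"
      then have qe: "q \<in> endpoints D'"
        unfolding endpoints_eq by blast
      obtain b where b: "q = Tail b \<or> q = Head b"
        by (cases q) auto
      then have "b \<in> arrows D'"
        using qe arrows_iff_Head[OF G'] by (auto simp: arrows_def)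
      then obtain a where a: "a \<in> arrows D" "b = h a"
        using h unfolding bij_betw_def by blast
      define p where "p = (if q = Tail b then Tail a else Head a)"
      have p: "q = map_endpoint h p" "p \<in> endpoints D"
        using a b arrows_iff_Head[OF G] by (auto simp: p_def arrows_def)
      then show "q \<in> map_endpoint h ` points D (Strand i)"
        using endpoint_h[OF p(2)] q by blast
    qed
  next
    case False
    then have "c \<notin> components D" "c \<notin> components D'"
      using string_link_components[OF D] string_link_components[OF D'] by auto
    then show ?thesis
      by (simp add: E_def points_def components_def domIff)
  qed
  have endpoints: "endpoints E = endpoints D'"
    by (simp add: endpoints_eq points_eq)
  have writhe_E: "writhe E = writhe D'"
    by (simp add: E_def)
  have comps: "components E = components D"
    by (auto simp: E_def components_def)
  have inj: "inj_on (map_endpoint h) (endpoints D)"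
  proof (rule inj_onI)
    fix p q assume pq: "p \<in> endpoints D" "q \<in> endpoints D" "map_endpoint h p = map_endpoint h q"
    have "a \<in> arrows D" if "Tail a \<in> endpoints D \<or> Head a \<in> endpoints D" for a
      using that arrows_iff_Head[OF G] by (auto simp: arrows_def)
    then show "p = q"
      using pq bij_betw_imp_inj_on[OF h] by (cases p; cases q) (auto simp: inj_on_def)
  qed
  have "gauss_diagram n E"
  proof (rule gauss_diagramI)
    show "distinct w" if w: "word E c = Some w" for c w
    proof -
      obtain v where v: "word D c = Some v" "w = map (map_endpoint h) v"
        using w by (auto simp: E_def)
      then have "set v \<subseteq> endpoints D"
        by (metis in_endpoints_iff subsetI)
      then show ?thesis
        using v gauss_diagramD(3)[OF G v(1)] inj by (auto simp: distinct_map intro: inj_on_subset)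
    qed
    show "c = c'" if "p \<in> points E c" "p \<in> points E c'" for p c c'
      using that gauss_diagramD(4)[OF G'] unfolding points_eq by blast
    show "writhe E a = 1 \<or> writhe E a = - 1" if "a \<in> arrows E" for a
      using that gauss_diagramD(6)[OF G', of a] by (simp add: writhe_E arrows_def endpoints)
  qed (use gauss_diagramD[OF G] gauss_diagramD(5)[OF G'] in \<open>simp_all add: comps endpoints\<close>)
  then have E: "E \<in> string_link_diagrams n"
    using D by (simp add: string_link_diagrams_def comps)
  have "isomorphism id D E"
  proof (rule isomorphism_string_linkI[OF D E, of h])
    show "inj_on h (arrows D)"
      using h by (rule bij_betw_imp_inj_on)
    show "writhe E (h a) = writhe D a" if a: "a \<in> arrows D" for a
    proof -
      obtain i j where "a \<in> arrows_between D i j"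
        using arrow_between[OF D a] by metis
      then show ?thesis
        using between_h[OF a, of i j "writhe D a"] by (simp add: E_def)
    qed
    show "the (word E (Strand i)) = map (map_endpoint h) (the (word D (Strand i)))" if "i \<in> {1..n}" for i
      by (rule string_link_word[OF D that]) (simp add: E_def)
  qed
  then have "(D, E) \<in> unwelded_equivalent n"
    using unwelded_move[OF D E] by blast
  moreover have "(E, D') \<in> unwelded_equivalent n"
    by (rule unwelded_same_points[OF E D']) (simp_all add: points_eq writhe_E)
  ultimately show ?thesis
    using unwelded_trans by blast
qed

section \<open>Both equivalences as the kernel of \<open>LK\<close>\<close>

lemma LK_unwelded: "(D, D') \<in> unwelded_equivalent n \<Longrightarrow> LK n D = LK n D'"
  unfolding LK_eq_iff using lk_cobordant unwelded_equivalent_cobordant by blast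

lemma unwelded_equivalent_iff:
  assumes D: "D \<in> string_link_diagrams n" "D' \<in> string_link_diagrams n"
  shows "(D, D') \<in> unwelded_equivalent n \<longleftrightarrow> LK n D = LK n D'"
proof
  assume eq: "LK n D = LK n D'"
  obtain E where E: "(D, E) \<in> unwelded_equivalent n" "reduced E"
    using unwelded_reduced[OF D(1)] by blast
  obtain E' where E': "(D', E') \<in> unwelded_equivalent n" "reduced E'"
    using unwelded_reduced[OF D(2)] by blast
  have "LK n E = LK n E'"
    using eq LK_unwelded E(1) E'(1) by metis
  then have "(E, E') \<in> unwelded_equivalent n"
    using unwelded_string_link E E' unfolding LK_eq_iff by (intro unwelded_reduced_eq) blast+
  then show "(D, D') \<in> unwelded_equivalent n"
    using E(1) E'(1) unwelded_trans unwelded_sym by meson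
qed (rule LK_unwelded)

lemma cobordant_iff_LK:
  assumes "D \<in> string_link_diagrams n" "D' \<in> string_link_diagrams n"
  shows "(D, D') \<in> cobordant n \<longleftrightarrow> LK n D = LK n D'"
proof
  show "LK n D = LK n D'" if "(D, D') \<in> cobordant n"
    unfolding LK_eq_iff using lk_cobordant[OF that] by blast
  show "(D, D') \<in> cobordant n" if "LK n D = LK n D'"
    using that unwelded_equivalent_iff[OF assms] unwelded_equivalent_cobordant by blast
qed


section \<open>Realisation of linking numbers\<close>

text \<open>Place \<open>\<bar>m i j\<bar>\<close> arrows with the sign of \<open>m i j\<close> from
  strand \<open>i\<close> to strand \<open>j\<close>. The name of an arrow encodes \<open>i\<close>,
  \<open>j\<close> and a running number, so its position can be read off from the name.\<close>

lemma string_link_with_linking_numbers: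
  fixes m :: "nat \<Rightarrow> nat \<Rightarrow> int"
  shows "\<exists>D \<in> string_link_diagrams n. \<forall>i \<in> {1..n}. \<forall>j \<in> {1..n}. lk D i j = m i j"
proof -
  define code where "code i j k = prod_encode (i, prod_encode (j, k))" for i j k :: nat
  define src where "src a = fst (prod_decode a)" for a
  define tgt where "tgt a = fst (prod_decode (snd (prod_decode a)))" for a
  define num where "num a = snd (prod_decode (snd (prod_decode a)))" for a
  have code [simp]: "src (code i j k) = i" "tgt (code i j k) = j" "num (code i j k) = k" for i j k
    by (simp_all add: code_def src_def tgt_def num_def)
  have code_eq: "code (src a) (tgt a) (num a) = a" for a
    by (simp add: code_def src_def tgt_def num_def)
  define A where "A = {a. src a \<in> {1..n} \<and> tgt a \<in> {1..n} \<and> num a < nat \<bar>m (src a) (tgt a)\<bar>}"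
  define s where "s a = (if m (src a) (tgt a) \<ge> 0 then 1 else - 1 :: int)" for a
  have A_eq: "A = (\<Union>i \<in> {1..n}. \<Union>j \<in> {1..n}. code i j ` {..<nat \<bar>m i j\<bar>})"
  proof (intro set_eqI iffI)
    fix a assume "a \<in> A"
    then have "a \<in> code (src a) (tgt a) ` {..<nat \<bar>m (src a) (tgt a)\<bar>}"
      unfolding A_def by (intro image_eqI[of _ _ "num a"]) (simp_all add: code_eq)
    then show "a \<in> (\<Union>i \<in> {1..n}. \<Union>j \<in> {1..n}. code i j ` {..<nat \<bar>m i j\<bar>})"
      using \<open>a \<in> A\<close> unfolding A_def by blast
  qed (auto simp: A_def)
  have fin: "finite A"
    unfolding A_eq by blast
  \<comment> \<open>The order along a strand does not affect linking numbers; all tails followed by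
    all heads is merely convenient.\<close>
  define w where "w i = map Tail (sorted_list_of_set {a \<in> A. src a = i}) @
      map Head (sorted_list_of_set {a \<in> A. tgt a = i})" for i
  define D where "D = \<lparr>word = (\<lambda>c. case c of Strand i \<Rightarrow> if i \<in> {1..n} then Some (w i) else None
      | Circle k \<Rightarrow> None), writhe = s\<rparr>"
  have set_w: "set (w i) = Tail ` {a \<in> A. src a = i} \<union> Head ` {a \<in> A. tgt a = i}" for i
    using fin by (simp add: w_def)
  have pts: "points D (Strand i) = set (w i)" if "i \<in> {1..n}" for i
    using that by (simp add: D_def points_def)
  have pts': "points D c = {}" if "c \<notin> Strand ` {1..n}" for c
    using that by (auto simp: D_def points_def split: component.splits)
  have comps: "components D = Strand ` {1..n}"
    by (auto simp: D_def components_def image_iff split: component.splits if_splits)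
  \<comment> \<open>An endpoint determines its strand through the name of its arrow, so no endpoint
    lies on two components.\<close>
  have owner: "c = Strand (case p of Tail a \<Rightarrow> src a | Head a \<Rightarrow> tgt a)" if p: "p \<in> points D c" for p c
  proof -
    obtain i where "c = Strand i" "i \<in> {1..n}"
      using p pts' by blast
    then show ?thesis
      using p pts[of i] set_w[of i] by auto
  qed
  have ends: "endpoints D = Tail ` A \<union> Head ` A"
  proof -
    have "endpoints D = (\<Union>i \<in> {1..n}. set (w i))"
    proof (intro set_eqI iffI)
      fix p assume "p \<in> endpoints D"
      then obtain c where c: "p \<in> points D c"
        unfolding endpoints_eq by blast
      then obtain i where "c = Strand i" "i \<in> {1..n}"
        using pts' by blast
      then show "p \<in> (\<Union>i \<in> {1..n}. set (w i))"
        using c pts by auto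
    next
      fix p assume "p \<in> (\<Union>i \<in> {1..n}. set (w i))"
      then show "p \<in> endpoints D"
        unfolding endpoints_eq using pts by blast
    qed
    also have "\<dots> = Tail ` A \<union> Head ` A"
      unfolding set_w by (auto simp: A_def)
    finally show ?thesis .
  qed
  have "gauss_diagram n D"
  proof (rule gauss_diagramI)
    show "distinct v" if "word D c = Some v" for c v
      using that fin
      by (auto simp: D_def w_def distinct_map inj_on_def split: component.splits if_splits)
    show "c = c'" if "p \<in> points D c" "p \<in> points D c'" for p c c'
      using owner that by metis
    show "Tail a \<in> endpoints D \<longleftrightarrow> Head a \<in> endpoints D" for a
      by (auto simp: ends)
    show "writhe D a = 1 \<or> writhe D a = - 1" for a
      by (simp add: D_def s_def)
  qed (auto simp: comps)
  then have D: "D \<in> string_link_diagrams n"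
    by (auto simp: string_link_diagrams_def comps)
  have "lk D i j = m i j" if ij: "i \<in> {1..n}" "j \<in> {1..n}" for i j
  proof -
    have "arrows_between D i j = {a \<in> A. src a = i \<and> tgt a = j}"
      unfolding arrows_between_def pts[OF ij(1)] pts[OF ij(2)] set_w by auto
    also have "\<dots> = code i j ` {..<nat \<bar>m i j\<bar>}"
    proof (intro set_eqI iffI)
      fix a assume "a \<in> {a \<in> A. src a = i \<and> tgt a = j}"
      then show "a \<in> code i j ` {..<nat \<bar>m i j\<bar>}"
        unfolding A_def by (intro image_eqI[of _ _ "num a"]) (use code_eq[of a] in auto)
    qed (use ij in \<open>auto simp: A_def\<close>)
    finally have "lk D i j = sum s (code i j ` {..<nat \<bar>m i j\<bar>})"
      unfolding lk_eq_arrows_between by (simp only: D_def diagram.select_convs)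
    also have "\<dots> = (\<Sum>k < nat \<bar>m i j\<bar>. s (code i j k))"
      by (subst sum.reindex) (auto simp: inj_on_def dest: arg_cong[where f = num])
    also have "\<dots> = m i j"
      by (simp add: s_def)
    finally show ?thesis .
  qed
  then show ?thesis
    using D by blast
qed

section \<open>The index list and surjectivity of \<open>LK\<close>\<close>

lemma strand_pairs_distinct: "distinct (strand_pairs n)"
proof -
  have "concat (map (\<lambda>j. if i \<noteq> j then [(i, j)] else []) xs) = map (Pair i) (filter ((\<noteq>) i) xs)"
    for i :: nat and xs
    by (induction xs) auto
  then have "strand_pairs n = filter (\<lambda>(i, j). i \<noteq> j) (List.product [1..<Suc n] [1..<Suc n])"
    by (simp add: strand_pairs_def product_concat_map filter_concat filter_map comp_def map_concat
        del: upt_Suc)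
  then show ?thesis
    by (simp add: distinct_product del: upt_Suc)
qed

lemma length_strand_pairs: "length (strand_pairs n) = n * (n - 1)"
proof -
  have "length (strand_pairs n) = card (set (strand_pairs n))"
    using strand_pairs_distinct by (rule distinct_card[symmetric])
  also have "set (strand_pairs n) = {1..n} \<times> {1..n} - (\<lambda>i. (i, i)) ` {1..n}"
    unfolding set_strand_pairs by auto
  also have "card \<dots> = n * n - n"
    by (subst card_Diff_subset) (auto simp: card_image inj_on_def)
  finally show ?thesis
    by (simp add: diff_mult_distrib2)
qed

text \<open>Because the index pairs are distinct, any list of the right length is the value list of
  a function on pairs, which can then be realised by a diagram.\<close>

lemma ex_map_eq:
  assumes "distinct xs" "length ys = length xs"
  obtains f where "map f xs = ys"
proof -
  have "map (\<lambda>x. the (map_of (zip xs ys) x)) xs = ys"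
    using assms by (intro nth_equalityI) (simp_all add: map_of_zip_nth)
  then show ?thesis
    by (rule that)
qed

lemma LK_image: "LK n ` string_link_diagrams n = {v. length v = n * (n - 1)}"
proof (intro set_eqI iffI)
  fix v :: "int list" assume "v \<in> {v. length v = n * (n - 1)}"
  then obtain f where f: "map f (strand_pairs n) = v"
    using ex_map_eq[OF strand_pairs_distinct[of n], of v] by (auto simp: length_strand_pairs)
  obtain D where D: "D \<in> string_link_diagrams n" "\<forall>i \<in> {1..n}. \<forall>j \<in> {1..n}. lk D i j = f (i, j)"
    using string_link_with_linking_numbers[of n "\<lambda>i j. f (i, j)"] by blast
  have "LK n D = v"
    unfolding LK_eq_map f[symmetric] using D(2) by (auto simp: set_strand_pairs)
  then show "v \<in> LK n ` string_link_diagrams n"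
    using D(1) by blast
qed (auto simp: LK_eq_map length_strand_pairs)

section \<open>Bijections induced on quotients by a kernel\<close>

lemma induces_bijection_kernel:
  assumes r: "\<And>x y. (x, y) \<in> r \<longleftrightarrow> x \<in> A \<and> y \<in> A \<and> f x = f y" and B: "f ` A = B"
  shows "induces_bijection f A r B"
proof -
  have equiv: "equiv A r"
    by (rule equivI) (auto simp: r refl_on_def sym_def trans_def)
  \<comment> \<open>\<open>the_elem\<close> is meaningful only on singletons; the image of a class
    is one, since \<open>f\<close> is constant on it and the class contains
    \<open>x\<close>.\<close>
  have val: "the_elem (f ` X) = f x" if "X = r `` {x}" "x \<in> A" for X x
  proof -
    have "f ` X = {f x}"
      using that by (auto simp: r)
    then show ?thesis
      by simp
  qed
  have "bij_betw (\<lambda>X. the_elem (f ` X)) (A // r) B"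
  proof (rule bij_betw_imageI)
    show "inj_on (\<lambda>X. the_elem (f ` X)) (A // r)"
    proof (rule inj_onI)
      fix X Y assume "X \<in> A // r" "Y \<in> A // r" and eq: "the_elem (f ` X) = the_elem (f ` Y)"
      then obtain x y where x: "X = r `` {x}" "x \<in> A" and y: "Y = r `` {y}" "y \<in> A"
        by (auto elim!: quotientE)
      then have "(x, y) \<in> r"
        using eq val by (simp add: r)
      then show "X = Y"
        using equiv_class_eq[OF equiv] x y by blast
    qed
    have "(\<lambda>X. the_elem (f ` X)) ` (A // r) = f ` A"
    proof (intro set_eqI iffI)
      fix v assume "v \<in> (\<lambda>X. the_elem (f ` X)) ` (A // r)"
      then obtain X where X: "X \<in> A // r" "v = the_elem (f ` X)"
        by blast
      from X(1) obtain x where "X = r `` {x}" "x \<in> A"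
        by (rule quotientE)
      then show "v \<in> f ` A"
        using X(2) val by blast
    next
      fix v assume "v \<in> f ` A"
      then obtain x where x: "x \<in> A" "v = f x"
        by blast
      then show "v \<in> (\<lambda>X. the_elem (f ` X)) ` (A // r)"
        using val[OF refl x(1)] quotientI[OF x(1), of r] by (metis imageI)
    qed
    then show "(\<lambda>X. the_elem (f ` X)) ` (A // r) = B"
      using B by simp
  qed
  moreover have "f respects r"
    by (rule congruentI) (simp add: r)
  ultimately show ?thesis
    using equiv by (simp add: induces_bijection_def)
qed

theorem mainTheorem2:
  fixes n :: nat
  assumes "n \<ge> 1"
  shows "induces_bijection (LK n) (string_link_diagrams n) (cobordant n)
           {v :: int list. length v = n * (n - 1)} \<and>
         induces_bijection (LK n) (string_link_diagrams n) (unwelded_equivalent n)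
           {v :: int list. length v = n * (n - 1)}"
proof
  show "induces_bijection (LK n) (string_link_diagrams n) (cobordant n)
      {v :: int list. length v = n * (n - 1)}"
    using cobordant_string_link cobordant_iff_LK LK_image by (intro induces_bijection_kernel) blast+
  show "induces_bijection (LK n) (string_link_diagrams n) (unwelded_equivalent n)
      {v :: int list. length v = n * (n - 1)}"
    using unwelded_string_link unwelded_equivalent_iff LK_image
    by (intro induces_bijection_kernel) blast+
qed


end
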